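(* Let $P\in\mathbb{R}^{n\times n}$ be a consensus matrix with invariant measure $\bm{\pi}$, let $\varPi=\operatorname{diag}(\bm{\pi})$ and $P^*=\varPi^{-1}P^{\mathsf T}\varPi$, and let $C_{P^*P}:=n\varPi P^*P=nP^{\mathsf T}\varPi P$, which is a conductance matrix. Let $\pi_{\min}$ and $\pi_{\max}$ be the minimum and maximum entries of $\bm{\pi}$. Then $$J(P)\le \frac{\pi_{\max}^3 n^2}{\pi_{\min}}\,\bar{\mathcal R}(C_{P^*P}),\qquad J_{\mathrm w}(P)\le \pi_{\max}^3 n^3\,\bar{\mathcal R}(C_{P^*P}).$$ Moreover, if $PP^*=P^*P$, then $$J(P)\ge \frac{\pi_{\min}^3 n^2}{\pi_{\max}}\,\bar{\mathcal R}(C_{P^*P}),\qquad J_{\mathrm w}(P)\ge \pi_{\min}^3 n^3\,\bar{\mathcal R}(C_{P^*P}).$$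
   Context: A consensus matrix is a matrix $P\in\mathbb{R}^{n\times n}$ with nonnegative entries that is row stochastic ($P\bm 1=\bm 1$, where $\bm 1$ is the all-ones vector), irreducible (the directed graph on $V=\{1,\dots,n\}$ with an edge $(u,v)$ iff $P_{uv}\ne 0$ is strongly connected), and has strictly positive diagonal entries. Its invariant measure $\bm\pi$ is the unique entrywise positive vector with $\bm\pi^{\mathsf T}P=\bm\pi^{\mathsf T}$ and $\sum_u\pi_u=1$. The linear quadratic (LQ) cost and its weighted version are $$J(P):=\frac1n\sum_{t\ge 0}\|P^t-\bm 1\bm\pi^{\mathsf T}\|_{\mathrm F}^2=\frac1n\operatorname{tr}\Big[\sum_{t\ge0}(I-\bm\pi\bm 1^{\mathsf T})(P^{\mathsf T})^tP^t(I-\bm 1\bm\pi^{\mathsf T})\Big],$$ $$J_{\mathrm w}(P):=\operatorname{tr}\Big[\sum_{t\ge0}(I-\bm\pi\bm 1^{\mathsf T})(P^{\mathsf T})^t\varPi P^t(I-\bm 1\bm\pi^{\mathsf T})\Big],$$ where $\|\cdot\|_{\mathrm F}$ is the Frobenius norm. A conductance matrix is a symmetric, entrywise nonnegative, irreducible matrix $C\in\mathbb{R}^{n\times n}$. Its Laplacian is $L(C):=\operatorname{diag}(C\bm 1)-C$. The effective resistance between $a$ and $b$ is $\mathcal R_{ab}(C):=(\bm e_a-\bm e_b)^{\mathsf T}\bm v$, where $\bm v$ is any solution of $L(C)\bm v=\bm e_a-\bm e_b$ (the value does not depend on the choice of solution); equivalently $\mathcal R_{ab}(C)=(\bm e_a-\bm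 e_b)^{\mathsf T}L(C)^\dagger(\bm e_a-\bm e_b)$, with $\dagger$ the Moore–Penrose pseudoinverse. The average effective resistance is $\bar{\mathcal R}(C):=\frac1{2n^2}\sum_{u,v\in V}\mathcal R_{uv}(C)$. *)

theory Defs
  imports "HOL-Analysis.Analysis"
begin

(* The vertex set {1..n} is the (arbitrary, finite, nonempty) index type 'n, with n = CARD('n).
   The all-ones vector is 1 :: real ^ 'n. *)

definition irreducible_matrix :: "real ^ 'n ^ 'n \<Rightarrow> bool" where
  "irreducible_matrix A \<longleftrightarrow> (\<forall>u v. (u, v) \<in> {(i, j). A $ i $ j \<noteq> 0}\<^sup>*)"

definition consensus_matrix :: "real ^ 'n ^ 'n \<Rightarrow> bool" where
  "consensus_matrix P \<longleftrightarrow>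
     (\<forall>u v. 0 \<le> P $ u $ v) \<and> P *v 1 = 1 \<and> irreducible_matrix P \<and> (\<forall>u. 0 < P $ u $ u)"

definition is_invariant_measure :: "real ^ 'n ^ 'n \<Rightarrow> real ^ 'n \<Rightarrow> bool" where
  "is_invariant_measure P \<pi> \<longleftrightarrow>
     (\<forall>u. 0 < \<pi> $ u) \<and> \<pi> v* P = \<pi> \<and> (\<Sum>u\<in>UNIV. \<pi> $ u) = 1"

(* Existence and uniqueness for consensus matrices is the Perron-Frobenius theorem. *)
definition invariant_measure :: "real ^ 'n ^ 'n \<Rightarrow> real ^ 'n" where
  "invariant_measure P = (THE \<pi>. is_invariant_measure P \<pi>)"

definition diag_matrix :: "real ^ 'n \<Rightarrow> real ^ 'n ^ 'n" where
  "diag_matrix x = (\<chi> i j. if i = j then x $ i else 0)"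

definition outer :: "real ^ 'n \<Rightarrow> real ^ 'n \<Rightarrow> real ^ 'n ^ 'n" where
  "outer x y = (\<chi> i j. x $ i * y $ j)"

(* The operator ^ inherited from the ring structure of vec would be the entrywise power. *)
primrec matrix_power :: "real ^ 'n ^ 'n \<Rightarrow> nat \<Rightarrow> real ^ 'n ^ 'n" where
  "matrix_power A 0 = mat 1"
| "matrix_power A (Suc t) = A ** matrix_power A t"

lemma norm_matrix_eq_frobenius:
  fixes A :: "real ^ 'n ^ 'm"
  shows "norm A = sqrt (\<Sum>i\<in>UNIV. \<Sum>j\<in>UNIV. (A $ i $ j)\<^sup>2)"
  by (simp add: norm_vec_def L2_set_def sum_nonneg)

definition lq_summand :: "real ^ 'n ^ 'n \<Rightarrow> nat \<Rightarrow> real" where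
  "lq_summand P t = (norm (matrix_power P t - outer 1 (invariant_measure P)))\<^sup>2"

definition lq_cost :: "real ^ 'n ^ 'n \<Rightarrow> real" where
  "lq_cost P = 1 / real CARD('n) * (\<Sum>t. lq_summand P t)"

definition weighted_lq_summand :: "real ^ 'n ^ 'n \<Rightarrow> nat \<Rightarrow> real ^ 'n ^ 'n" where
  "weighted_lq_summand P t =
     (let \<pi> = invariant_measure P in
        (mat 1 - outer \<pi> 1) ** matrix_power (transpose P) t ** diag_matrix \<pi>
          ** matrix_power P t ** (mat 1 - outer 1 \<pi>))"

definition weighted_lq_cost :: "real ^ 'n ^ 'n \<Rightarrow> real" where
  "weighted_lq_cost P = trace (\<Sum>t. weighted_lq_summand P t)"

definition conductance_matrix :: "real ^ 'n ^ 'n \<Rightarrow> bool" where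
  "conductance_matrix C \<longleftrightarrow>
     transpose C = C \<and> (\<forall>u v. 0 \<le> C $ u $ v) \<and> irreducible_matrix C"

definition laplacian :: "real ^ 'n ^ 'n \<Rightarrow> real ^ 'n ^ 'n" where
  "laplacian C = diag_matrix (C *v 1) - C"

(* For a conductance matrix a solution x exists and the value does not depend on its choice. *)
definition effective_resistance :: "real ^ 'n ^ 'n \<Rightarrow> 'n \<Rightarrow> 'n \<Rightarrow> real" where
  "effective_resistance C a b =
     (axis a 1 - axis b 1) \<bullet> (SOME x. laplacian C *v x = axis a 1 - axis b 1)"

definition avg_effective_resistance :: "real ^ 'n ^ 'n \<Rightarrow> real" where
  "avg_effective_resistance C =
     1 / (2 * (real CARD('n))\<^sup>2) * (\<Sum>u\<in>UNIV. \<Sum>v\<in>UNIV. effective_resistance C u v)"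

end

theory Submission
  imports Defs
begin

text \<open>
  Let \<open>S\<close> be \<open>P\<close> conjugated by the square root of \<open>diag_matrix \<pi>\<close>. In these coordinates the
  adjoint \<open>P\<^sup>*\<close> is the transpose of \<open>S\<close>, the unit vector \<open>\<surd>\<pi>\<close> is fixed by \<open>S\<close> and by its
  transpose, and \<open>T\<close>, obtained from \<open>S\<close> by subtracting the projection onto \<open>\<surd>\<pi>\<close>, satisfies
  \<open>norm (T x) < norm x\<close> for \<open>x \<noteq> 0\<close>: the defect \<open>I - T\<^sup>T T\<close> is, up to the same conjugation,
  the Laplacian of the conductance matrix divided by \<open>n\<close> plus the rank one matrix of \<open>\<pi>\<close>,
  and a Laplacian vanishes only on constants.

  Two traces are compared. On the one side, the terms of the weighted cost are
  \<open>\<surd>\<Pi> (T\<^sup>t)\<^sup>T T\<^sup>t \<surd>\<Pi>\<close> for \<open>t > 0\<close>, so that up to a factor between the extreme entries of \<open>\<pi>\<close>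
  this cost is the trace of \<open>X = \<Sum>t. (T\<^sup>t)\<^sup>T T\<^sup>t\<close>, minus \<open>1\<close> for the direction \<open>\<surd>\<pi>\<close>; the plain
  cost follows, as it is a sum over the same squares without the weights \<open>\<pi>\<^sub>k\<close>. On the other side, solving the Laplace equation with the inverse \<open>Y\<close> of the defect expresses
  \<open>trace Y - 1\<close> as \<open>n / 2\<close> times the sum of all effective resistances between \<open>u\<close> and \<open>v\<close>
  weighted by \<open>\<pi>\<^sub>u \<pi>\<^sub>v\<close> (\<open>trace_green\<close>).

  The link is the inequality \<open>trace X \<le> trace Y\<close> for strict contractions
  (\<open>trace_gramian_le\<close>), an equality if \<open>T\<close> is normal, because then \<open>T\<close> commutes with \<open>X\<close> and
  the Lyapunov equation \<open>X = I + T\<^sup>T X T\<close> says that \<open>X\<close> is the inverse of the defect. The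
  inequality would follow from Horn's inequalities between the singular values of \<open>T\<^sup>t\<close> and
  of \<open>T\<close>; the proof here avoids singular values. A positive semidefinite symmetric \<open>N\<close> with
  inverse \<open>Y\<close> satisfies \<open>trace Y \<ge> 2 * trace Z - Z \<bullet> N Z\<close> for every \<open>Z\<close>. Taking \<open>Z = X\<close> for
  both defects \<open>I - T\<^sup>T T\<close> and \<open>I - T T\<^sup>T\<close>, whose inverses have the same trace, the sum of
  the two bounds is at least \<open>2 * trace X\<close> by the Lyapunov equation and
  \<open>2 * (T X \<bullet> X T) \<le> norm (T X)\<^sup>2 + norm (X T)\<^sup>2\<close>.
\<close>

section \<open>Matrices with the Frobenius inner product\<close>

lemma bounded_bilinear_matrix_mult:
  "bounded_bilinear ((**) :: real ^ 'n ^ 'm \<Rightarrow> real ^ 'p ^ 'n \<Rightarrow> real ^ 'p ^ 'm)"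
  unfolding bilinear_conv_bounded_bilinear[symmetric] bilinear_def linear_iff
  by (simp add: vec_eq_iff matrix_matrix_mult_def sum.distrib algebra_simps sum_distrib_left)

lemmas matrix_diff_rdistrib = bounded_bilinear.diff_left[OF bounded_bilinear_matrix_mult]
lemmas matrix_diff_ldistrib = bounded_bilinear.diff_right[OF bounded_bilinear_matrix_mult]

lemma bounded_linear_trace: "bounded_linear (trace :: real ^ 'n ^ 'n \<Rightarrow> real)"
  unfolding linear_conv_bounded_linear[symmetric] linear_iff
  by (simp add: trace_def sum.distrib sum_distrib_left)

lemma bounded_linear_transpose: "bounded_linear (transpose :: real ^ 'n ^ 'm \<Rightarrow> real ^ 'm ^ 'n)"
  unfolding linear_conv_bounded_linear[symmetric] linear_iff
  by (simp add: vec_eq_iff transpose_def)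

lemmas transpose_diff = linear_diff[OF bounded_linear.linear[OF bounded_linear_transpose]]

lemma inner_matrix_eq: "A \<bullet> B = (\<Sum>i\<in>UNIV. \<Sum>j\<in>UNIV. A $ i $ j * B $ i $ j)"
  for A B :: "real ^ 'n ^ 'm"
  by (simp add: inner_vec_def)

lemma inner_transpose: "transpose A \<bullet> transpose B = A \<bullet> B"
  for A B :: "real ^ 'n ^ 'm"
  unfolding inner_matrix_eq by (subst sum.swap) (simp add: transpose_def)

lemma norm_transpose: "norm (transpose A) = norm A" for A :: "real ^ 'n ^ 'm"
  by (simp add: norm_eq_sqrt_inner inner_transpose)

lemma inner_matrix_mult_left: "(A ** B) \<bullet> C = B \<bullet> (transpose A ** C)"
  for A :: "real ^ 'n ^ 'm" and B :: "real ^ 'p ^ 'n"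
proof -
  have "(A ** B) \<bullet> C = (\<Sum>i\<in>UNIV. \<Sum>j\<in>UNIV. \<Sum>k\<in>UNIV. A $ i $ k * B $ k $ j * C $ i $ j)"
    by (simp add: inner_matrix_eq matrix_matrix_mult_def sum_distrib_right)
  also have "\<dots> = (\<Sum>j\<in>UNIV. \<Sum>i\<in>UNIV. \<Sum>k\<in>UNIV. A $ i $ k * B $ k $ j * C $ i $ j)"
    by (rule sum.swap)
  also have "\<dots> = (\<Sum>j\<in>UNIV. \<Sum>k\<in>UNIV. \<Sum>i\<in>UNIV. A $ i $ k * B $ k $ j * C $ i $ j)"
    by (intro sum.cong refl sum.swap)
  also have "\<dots> = (\<Sum>k\<in>UNIV. \<Sum>j\<in>UNIV. \<Sum>i\<in>UNIV. A $ i $ k * B $ k $ j * C $ i $ j)"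
    by (rule sum.swap)
  also have "\<dots> = B \<bullet> (transpose A ** C)"
    by (simp add: inner_matrix_eq matrix_matrix_mult_def transpose_def sum_distrib_left mult_ac)
  finally show ?thesis .
qed

lemma inner_mat_1: "mat 1 \<bullet> A = trace A" for A :: "real ^ 'n ^ 'n"
  by (simp add: inner_matrix_eq mat_def trace_def if_distrib if_distribR cong: if_cong)

lemma norm_matrix_sq_columns: "(norm A)\<^sup>2 = (\<Sum>j\<in>UNIV. (norm (A *v axis j 1))\<^sup>2)"
  for A :: "real ^ 'n ^ 'm"
  unfolding power2_norm_eq_inner inner_matrix_eq
  by (subst sum.swap) (simp add: inner_vec_def matrix_vector_mult_basis column_def)

lemma norm_matrix_mult_le:
  fixes T :: "real ^ 'n ^ 'm" and B :: "real ^ 'p ^ 'n"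
  assumes "\<And>x. norm (T *v x) \<le> c * norm x" and "0 \<le> c"
  shows "norm (T ** B) \<le> c * norm B"
proof (rule power2_le_imp_le)
  have "(norm (T ** B))\<^sup>2 \<le> (\<Sum>j\<in>UNIV. c\<^sup>2 * (norm (B *v axis j 1))\<^sup>2)"
    unfolding norm_matrix_sq_columns[of "T ** B"]
    by (intro sum_mono)
       (simp add: assms(1) power_mono matrix_vector_mul_assoc[symmetric] flip: power_mult_distrib)
  then show "(norm (T ** B))\<^sup>2 \<le> (c * norm B)\<^sup>2"
    by (simp add: norm_matrix_sq_columns[of B] power_mult_distrib sum_distrib_left)
qed (simp add: assms(2))

text \<open>
  Cauchy-Schwarz for \<open>x\<close> and \<open>T T\<^sup>T x\<close>, followed by cancelling \<open>norm (T\<^sup>T x)\<close>.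
\<close>

lemma norm_transpose_mult_vec_le:
  fixes T :: "real ^ 'n ^ 'm"
  assumes "\<And>x. norm (T *v x) \<le> norm x"
  shows "norm (transpose T *v x) \<le> norm x"
proof -
  have "(norm (transpose T *v x))\<^sup>2 = x \<bullet> (T *v (transpose T *v x))"
    by (simp add: power2_norm_eq_inner dot_lmul_matrix)
  also have "\<dots> \<le> norm x * norm (T *v (transpose T *v x))"
    by (rule norm_cauchy_schwarz)
  also have "\<dots> \<le> norm x * norm (transpose T *v x)"
    by (rule mult_left_mono) (auto intro: assms)
  finally have
      "norm (transpose T *v x) * norm (transpose T *v x) \<le> norm x * norm (transpose T *v x)"
    by (simp only: power2_eq_square)
  then show ?thesis
    by (cases "transpose T *v x = 0") (simp_all del: transpose_matrix_vector)
qed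

lemma matrix_inv_mult:
  fixes A :: "real ^ 'n ^ 'n"
  assumes "invertible A"
  shows "A ** matrix_inv A = mat 1" and "matrix_inv A ** A = mat 1"
  using someI_ex[OF assms[unfolded invertible_def], folded matrix_inv_def] by blast+

lemma matrix_mult_diag_matrix: "(A ** diag_matrix d) $ i $ j = A $ i $ j * d $ j"
  by (simp add: matrix_matrix_mult_def diag_matrix_def mult_delta_right)

lemma diag_matrix_mult: "(diag_matrix d ** A) $ i $ j = d $ i * A $ i $ j"
  by (simp add: matrix_matrix_mult_def diag_matrix_def mult_delta_left)

lemma matrix_power_commute: "matrix_power A t ** A = A ** matrix_power A t"
  by (induction t) (simp_all flip: matrix_mul_assoc)

lemma matrix_power_transpose: "matrix_power (transpose A) t = transpose (matrix_power A t)"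
  by (induction t) (simp_all add: matrix_transpose_mul flip: matrix_power_commute)

section \<open>Strict contractions and the trace of the Gramian\<close>

definition strict_contraction :: "real ^ 'n ^ 'm \<Rightarrow> bool" where
  "strict_contraction T \<longleftrightarrow> (\<forall>x. x \<noteq> 0 \<longrightarrow> norm (T *v x) < norm x)"

text \<open>
  The unit sphere is compact, so the strict inequalities on it have a common factor below
  \<open>1\<close>; this is what makes the powers decay geometrically.
\<close>

lemma strict_contraction_uniform:
  fixes T :: "real ^ 'n ^ 'm"
  assumes T: "strict_contraction T"
  shows "\<exists>c. 0 \<le> c \<and> c < 1 \<and> (\<forall>x. norm (T *v x) \<le> c * norm x)"
proof -
  have "\<exists>x\<in>sphere 0 1. \<forall>y\<in>sphere 0 1. norm (T *v y) \<le> norm (T *v x)"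
  proof (rule continuous_attains_sup)
    have "axis undefined 1 \<in> sphere (0 :: real ^ 'n) 1"
      by (simp add: norm_axis_1)
    then show "sphere (0 :: real ^ 'n) 1 \<noteq> {}"
      by blast
    show "continuous_on (sphere 0 1) (\<lambda>x. norm (T *v x))"
      by (intro continuous_on_norm linear_continuous_on matrix_vector_mul_bounded_linear)
  qed auto
  then obtain z where z: "norm z = 1" and max: "\<And>y. norm y = 1 \<Longrightarrow> norm (T *v y) \<le> norm (T *v z)"
    by auto
  show ?thesis
  proof (intro exI conjI allI)
    have "z \<noteq> 0"
      using z by auto
    then show "norm (T *v z) < 1"
      using T z by (auto simp: strict_contraction_def)
    fix x
    show "norm (T *v x) \<le> norm (T *v z) * norm x"
    proof (cases "x = 0")
      case False
      have "norm (T *v (inverse (norm x) *\<^sub>R x)) \<le> norm (T *v z)"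
        by (rule max) (simp add: False)
      then show ?thesis
        by (simp add: matrix_vector_mult_scaleR False field_simps)
    qed simp
  qed simp
qed

lemma strict_contraction_norm_le:
  fixes T :: "real ^ 'n ^ 'm"
  assumes "strict_contraction T"
  shows "norm (T *v x) \<le> norm x"
  using assms by (cases "x = 0") (auto simp: strict_contraction_def less_imp_le)

text \<open>
  The observability Gramian of the system \<open>x \<mapsto> T x\<close> with identity output.
\<close>

definition gramian :: "real ^ 'n ^ 'n \<Rightarrow> real ^ 'n ^ 'n" where
  "gramian T = (\<Sum>t. transpose (matrix_power T t) ** matrix_power T t)"

lemma summable_gramian:
  fixes T :: "real ^ 'n ^ 'n"
  assumes "strict_contraction T"
  shows "summable (\<lambda>t. transpose (matrix_power T t) ** matrix_power T t)"
proof -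
  obtain c where c: "0 \<le> c" "c < 1" "\<And>x. norm (T *v x) \<le> c * norm x"
    using strict_contraction_uniform[OF assms] by blast
  have pow: "norm (matrix_power T t) \<le> c ^ t * norm (mat 1 :: real ^ 'n ^ 'n)" for t
  proof (induction t)
    case (Suc t)
    have "norm (T ** matrix_power T t) \<le> c * norm (matrix_power T t)"
      by (rule norm_matrix_mult_le) (simp_all add: c(1,3))
    also have "\<dots> \<le> c * (c ^ t * norm (mat 1 :: real ^ 'n ^ 'n))"
      by (rule mult_left_mono) (use Suc c(1) in auto)
    finally show ?case by simp
  qed simp
  have "\<exists>K>0. \<forall>(A :: real ^ 'n ^ 'n) (B :: real ^ 'n ^ 'n). norm (A ** B) \<le> norm A * norm B * K"
    by (rule bounded_bilinear.pos_bounded[OF bounded_bilinear_matrix_mult])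
  then obtain K where K: "0 < K"
      "\<And>(A :: real ^ 'n ^ 'n) (B :: real ^ 'n ^ 'n). norm (A ** B) \<le> norm A * norm B * K"
    by auto
  define q where "q = norm (mat 1 :: real ^ 'n ^ 'n)"
  show ?thesis
  proof (rule summable_comparison_test)
    have "c * c < 1"
      using mult_strict_mono'[OF c(2,2) c(1,1)] by simp
    then show "summable (\<lambda>t. q * q * K * (c * c) ^ t)"
      using c(1) by (intro summable_mult summable_geometric) simp
    have "norm (transpose (matrix_power T t) ** matrix_power T t) \<le> q * q * K * (c * c) ^ t" for t
    proof -
      have "norm (transpose (matrix_power T t) ** matrix_power T t)
          \<le> norm (matrix_power T t) * norm (matrix_power T t) * K"
        using K(2)[of "transpose (matrix_power T t)" "matrix_power T t"]
        by (simp only: norm_transpose)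
      also have "\<dots> \<le> (c ^ t * q) * (c ^ t * q) * K"
        unfolding q_def using K(1) c(1)
        by (intro mult_right_mono mult_mono pow) simp_all
      also have "\<dots> = q * q * K * (c * c) ^ t"
        unfolding power_mult_distrib by (simp only: mult_ac)
      finally show ?thesis .
    qed
    then show "\<exists>N. \<forall>t\<ge>N. norm (transpose (matrix_power T t) ** matrix_power T t)
        \<le> q * q * K * (c * c) ^ t"
      by blast
  qed
qed

lemma transpose_gramian:
  assumes "strict_contraction T"
  shows "transpose (gramian T) = gramian T"
  unfolding gramian_def
  by (subst bounded_linear.suminf[OF bounded_linear_transpose summable_gramian[OF assms]])
     (simp_all add: matrix_transpose_mul)

text \<open>
  The discrete Lyapunov equation: splitting off the term \<open>t = 0\<close> shifts the series by one
  power of \<open>T\<close> on each side.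
\<close>

lemma gramian_fixpoint:
  assumes "strict_contraction T"
  shows "gramian T = mat 1 + transpose T ** gramian T ** T"
proof -
  let ?X = "\<lambda>t. transpose (matrix_power T t) ** matrix_power T t"
  have lin: "bounded_linear (\<lambda>Z. transpose T ** Z ** T)"
    using bounded_linear_compose[OF
        bounded_bilinear.bounded_linear_left[OF bounded_bilinear_matrix_mult, of T]
        bounded_bilinear.bounded_linear_right[OF bounded_bilinear_matrix_mult, of "transpose T"]]
    by simp
  have X: "?X (Suc t) = transpose T ** ?X t ** T" for t
    by (simp add: matrix_transpose_mul matrix_mul_assoc flip: matrix_power_commute)
  have "gramian T = ?X 0 + (\<Sum>t. ?X (Suc t))"
    unfolding gramian_def using suminf_split_head[OF summable_gramian[OF assms]] by simp
  also have "(\<Sum>t. ?X (Suc t)) = transpose T ** gramian T ** T"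
    unfolding X gramian_def
    by (rule bounded_linear.suminf[OF lin summable_gramian[OF assms], symmetric])
  finally show ?thesis by simp
qed

abbreviation defect :: "real ^ 'n ^ 'n \<Rightarrow> real ^ 'n ^ 'n" where
  "defect T \<equiv> mat 1 - transpose T ** T"

lemma invertible_defect:
  fixes T :: "real ^ 'n ^ 'n"
  assumes "strict_contraction T"
  shows "invertible (defect T)"
  unfolding invertible_left_inverse matrix_left_invertible_ker
proof (intro allI impI)
  fix x assume "defect T *v x = 0"
  then have "x = transpose T *v (T *v x)"
    by (simp add: matrix_vector_mult_diff_rdistrib matrix_vector_mul_assoc del:
        transpose_matrix_vector)
  then have "x \<bullet> x = (T *v x) \<bullet> (T *v x)"
    by (metis dot_lmul_matrix transpose_matrix_vector)
  then have "norm (T *v x) = norm x"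
    by (simp add: norm_eq_sqrt_inner)
  then show "x = 0"
    using assms by (metis strict_contraction_def less_irrefl)
qed

text \<open>
  The left side is concave in \<open>Z\<close> with maximum at the inverse \<open>Y\<close>: the gap is the quadratic
  form of \<open>N\<close> at \<open>Z - Y\<close>.
\<close>

lemma trace_inverse_variational:
  fixes N Y Z :: "real ^ 'n ^ 'n"
  assumes "transpose N = N" and "\<And>W :: real ^ 'n ^ 'n. 0 \<le> W \<bullet> (N ** W)" and "N ** Y = mat 1"
  shows "2 * trace Z - Z \<bullet> (N ** Z) \<le> trace Y"
proof -
  have NY: "W \<bullet> (N ** Y) = trace W" for W
    by (simp only: assms(3) inner_mat_1 inner_commute[of W])
  have "Y \<bullet> (N ** Z) = (N ** Y) \<bullet> Z"
    by (simp only: inner_matrix_mult_left assms(1))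
  also have "\<dots> = trace Z"
    by (simp only: assms(3) inner_mat_1)
  finally show ?thesis
    using assms(2)[of "Z - Y"] NY[of Z] NY[of Y]
    unfolding matrix_diff_ldistrib inner_diff_left inner_diff_right by linarith
qed

lemma inner_defect:
  fixes T W :: "real ^ 'n ^ 'n"
  shows "W \<bullet> (defect T ** W) = (norm W)\<^sup>2 - (norm (T ** W))\<^sup>2"
  unfolding power2_norm_eq_inner
  by (simp only: matrix_diff_rdistrib inner_diff_right inner_matrix_mult_left matrix_mul_assoc
      matrix_mul_lid)

lemma transpose_defect: "transpose (defect T) = defect T"
  for T :: "real ^ 'n ^ 'n"
  by (simp add: transpose_diff matrix_transpose_mul)

text \<open>
  The defects of \<open>T\<close> and of its transpose have inverses of equal trace, so that
  \<open>trace_inverse_variational\<close> bounds the same number from below for both.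
\<close>

lemma inverse_dual_defect:
  fixes T Y :: "real ^ 'n ^ 'n"
  assumes "defect T ** Y = mat 1"
  shows "(mat 1 - T ** transpose T) ** (mat 1 + T ** Y ** transpose T) = mat 1"
    and "trace (mat 1 + T ** Y ** transpose T) = trace Y"
proof -
  have Y: "transpose T ** T ** Y = Y - mat 1"
    using assms by (simp add: matrix_diff_rdistrib algebra_simps)
  have "T ** transpose T ** (T ** Y ** transpose T) = T ** (transpose T ** T ** Y) ** transpose T"
    by (simp add: matrix_mul_assoc)
  also have "\<dots> = T ** Y ** transpose T - T ** transpose T"
    by (simp add: Y matrix_diff_ldistrib matrix_diff_rdistrib)
  finally show "(mat 1 - T ** transpose T) ** (mat 1 + T ** Y ** transpose T) = mat 1"
    by (simp add: matrix_diff_rdistrib matrix_add_ldistrib)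
  have "trace (T ** Y ** transpose T) = trace (Y - mat 1)"
    using trace_mul_sym[of "T ** Y" "transpose T"] by (simp add: matrix_mul_assoc Y)
  then show "trace (mat 1 + T ** Y ** transpose T) = trace Y"
    by (simp add: linear_add[OF bounded_linear.linear[OF bounded_linear_trace]]
        linear_diff[OF bounded_linear.linear[OF bounded_linear_trace]])
qed

text \<open>
  A bound by one of the two defects alone would need to compare \<open>norm (T X)\<close> with
  \<open>norm (X T)\<close>. Averaging the bounds of both defects avoids this, because the mixed term
  \<open>T X \<bullet> X T\<close> of the Lyapunov equation is at most the mean of the two squared norms.
\<close>

theorem trace_gramian_le:
  fixes T Y :: "real ^ 'n ^ 'n"
  assumes T: "strict_contraction T"
    and Y: "defect T ** Y = mat 1"
  shows "trace (gramian T) \<le> trace Y"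
proof -
  let ?X = "gramian T"
  note Tle = strict_contraction_norm_le[OF T]
  have "norm (T ** W) \<le> 1 * norm W" for W :: "real ^ 'n ^ 'n"
    by (rule norm_matrix_mult_le) (simp_all add: Tle)
  moreover have "norm (transpose T ** W) \<le> 1 * norm W" for W :: "real ^ 'n ^ 'n"
    by (rule norm_matrix_mult_le)
       (simp_all add: norm_transpose_mult_vec_le[of T, OF Tle] del: transpose_matrix_vector)
  ultimately have psd: "0 \<le> W \<bullet> (defect T ** W)"
      "0 \<le> W \<bullet> ((mat 1 - T ** transpose T) ** W)" for W :: "real ^ 'n ^ 'n"
    using inner_defect[of W T] inner_defect[of W "transpose T"]
    by (simp_all only: transpose_transpose) (simp_all add: power_mono)
  have lower: "2 * trace ?X - ((norm ?X)\<^sup>2 - (norm (T ** ?X))\<^sup>2) \<le> trace Y"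
    using trace_inverse_variational[OF transpose_defect psd(1) Y, of ?X]
    by (simp only: inner_defect)
  have sym: "transpose (mat 1 - T ** transpose T) = mat 1 - T ** transpose T"
    using transpose_defect[of "transpose T"] by (simp only: transpose_transpose)
  have "2 * trace ?X - ((norm ?X)\<^sup>2 - (norm (transpose T ** ?X))\<^sup>2) \<le> trace Y"
    using trace_inverse_variational[OF sym psd(2) inverse_dual_defect(1)[OF Y], of ?X]
      inner_defect[of ?X "transpose T"]
    by (simp only: inverse_dual_defect(2)[OF Y] transpose_transpose)
  moreover have "norm (transpose T ** ?X) = norm (?X ** T)"
    using norm_transpose[of "?X ** T"] by (simp only: matrix_transpose_mul transpose_gramian[OF T])
  ultimately have upper: "2 * trace ?X - ((norm ?X)\<^sup>2 - (norm (?X ** T))\<^sup>2) \<le> trace Y"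
    by simp
  \<comment> \<open>The Lyapunov equation tested against \<open>X\<close> itself produces the mixed term.\<close>
  have "?X \<bullet> ?X = ?X \<bullet> (mat 1 + transpose T ** ?X ** T)"
    using gramian_fixpoint[OF T] by (rule arg_cong)
  then have "(norm ?X)\<^sup>2 = trace ?X + ?X \<bullet> (transpose T ** (?X ** T))"
    by (simp only: power2_norm_eq_inner inner_add_right inner_mat_1 inner_commute[of ?X "mat 1"]
        matrix_mul_assoc)
  also have "?X \<bullet> (transpose T ** (?X ** T)) = (T ** ?X) \<bullet> (?X ** T)"
    by (simp only: inner_matrix_mult_left)
  finally have "(norm ?X)\<^sup>2 = trace ?X + (T ** ?X) \<bullet> (?X ** T)" .
  moreover have "(T ** ?X) \<bullet> (?X ** T) \<le> ((norm (T ** ?X))\<^sup>2 + (norm (?X ** T))\<^sup>2) / 2"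
  proof -
    have "0 \<le> (norm (T ** ?X - ?X ** T))\<^sup>2"
      by simp
    also have "\<dots> = (norm (T ** ?X))\<^sup>2 + (norm (?X ** T))\<^sup>2 - 2 * ((T ** ?X) \<bullet> (?X ** T))"
      unfolding power2_norm_eq_inner inner_diff_left inner_diff_right
      using inner_commute[of "?X ** T" "T ** ?X"] by linarith
    finally show ?thesis by simp
  qed
  \<comment> \<open>Adding the bounds from both defects and eliminating the mixed term is linear arithmetic.\<close>
  moreover have "t \<le> y" if "m = t + z" "z \<le> (p + q) / 2" "2 * t - (m - p) \<le> y" "2 * t - (m - q) \<le> y"
    for t m z p q y :: real
    using that by (simp add: field_simps)
  ultimately show ?thesis
    using lower upper by blast
qed

text \<open>
  Normality makes every summand of the Gramian commute with \<open>T\<close>, so the Lyapunov equation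
  factors as \<open>(I - T\<^sup>T T) X = I\<close>.
\<close>

lemma trace_gramian_normal:
  fixes T Y :: "real ^ 'n ^ 'n"
  assumes T: "strict_contraction T"
    and Y: "defect T ** Y = mat 1"
    and normal: "T ** transpose T = transpose T ** T"
  shows "trace (gramian T) = trace Y"
proof -
  let ?X = "\<lambda>t. transpose (matrix_power T t) ** matrix_power T t"
  have tr: "T ** transpose (matrix_power T t) = transpose (matrix_power T t) ** T" for t
  proof (induction t)
    case (Suc t)
    have "T ** transpose (matrix_power T (Suc t))
        = T ** (transpose T ** transpose (matrix_power T t))"
      by (simp add: matrix_transpose_mul flip: matrix_power_commute)
    also have "\<dots> = transpose T ** (T ** transpose (matrix_power T t))"
      by (simp add: matrix_mul_assoc normal)
    also have "\<dots> = transpose (matrix_power T (Suc t)) ** T"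
      by (simp add: Suc matrix_mul_assoc matrix_transpose_mul flip: matrix_power_commute)
    finally show ?case .
  qed simp
  have "T ** ?X t = ?X t ** T" for t
  proof -
    have "T ** ?X t = transpose (matrix_power T t) ** (T ** matrix_power T t)"
      by (simp add: matrix_mul_assoc tr)
    then show ?thesis
      by (simp add: matrix_mul_assoc flip: matrix_power_commute)
  qed
  then have "T ** gramian T = gramian T ** T"
    unfolding gramian_def
    using bounded_linear.suminf[OF bounded_bilinear.bounded_linear_right[OF
        bounded_bilinear_matrix_mult, of T]
        summable_gramian[OF T]]
      bounded_linear.suminf[OF bounded_bilinear.bounded_linear_left[OF
          bounded_bilinear_matrix_mult, of T]
        summable_gramian[OF T]]
    by simp
  then have "transpose T ** T ** gramian T = transpose T ** gramian T ** T"
    by (simp flip: matrix_mul_assoc)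
  then have "defect T ** gramian T = mat 1"
    unfolding matrix_diff_rdistrib diff_eq_eq matrix_mul_lid using gramian_fixpoint[OF T] by simp
  moreover have "Y ** defect T = mat 1"
    using Y matrix_left_right_inverse by blast
  ultimately have "gramian T = Y"
    by (metis matrix_mul_assoc matrix_mul_lid matrix_mul_rid)
  then show ?thesis by simp
qed

section \<open>The invariant measure\<close>

text \<open>
  Positivity of the invariant measure, its uniqueness and the kernel of a Laplacian all come
  from propagating a property along edges.
\<close>

lemma irreducible_closed_set:
  assumes "irreducible_matrix A" and "u \<in> S" and "\<And>i j. i \<in> S \<Longrightarrow> A $ i $ j \<noteq> 0 \<Longrightarrow> j \<in> S"
  shows "v \<in> S"
proof -
  have "(u, v) \<in> {(i, j). A $ i $ j \<noteq> 0}\<^sup>*"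
    using assms(1) unfolding irreducible_matrix_def by blast
  then show ?thesis
    by (induction rule: rtrancl_induct) (use assms(2,3) in auto)
qed

lemma consensus_row_sum: "consensus_matrix P \<Longrightarrow> (\<Sum>j\<in>UNIV. P $ i $ j) = 1"
  unfolding consensus_matrix_def by (simp add: vec_eq_iff matrix_vector_mult_def)

lemma is_invariant_measure_column_sum:
  "is_invariant_measure P \<pi> \<Longrightarrow> (\<Sum>i\<in>UNIV. \<pi> $ i * P $ i $ j) = \<pi> $ j"
  unfolding is_invariant_measure_def vector_matrix_mult_def vec_eq_iff by (simp add: mult.commute)

text \<open>
  The map \<open>x \<mapsto> x v* P\<close> preserves the simplex of probability vectors, so Brouwer's theorem
  gives a fixed point. Its support is closed under the edges of \<open>P\<close>, hence is everything.
\<close>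

lemma invariant_measure_exists:
  fixes P :: "real ^ 'n ^ 'n"
  assumes P: "consensus_matrix P"
  shows "\<exists>\<pi>. is_invariant_measure P \<pi>"
proof -
  have nonneg: "0 \<le> P $ u $ v" for u v
    using P unfolding consensus_matrix_def by blast
  define S where "S = {x :: real ^ 'n. (\<forall>u. 0 \<le> x $ u) \<and> (\<Sum>u\<in>UNIV. x $ u) = 1}"
  obtain x where x: "x \<in> S" "x v* P = x"
  proof (rule brouwer[of S "\<lambda>x. x v* P"])
    have "closed S"
      unfolding S_def
      by (intro closed_Collect_conj closed_Collect_all closed_Collect_le closed_Collect_eq
          continuous_intros)
    moreover have "bounded S"
      unfolding bounded_iff
    proof (intro exI ballI)
      fix x assume "x \<in> S"
      then show "norm x \<le> 1"
        using norm_le_l1_cart[of x] by (simp add: S_def)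
    qed
    ultimately show "compact S"
      by (simp add: compact_eq_bounded_closed)
    show "convex S"
      unfolding S_def convex_def by (auto simp: sum.distrib simp flip: sum_distrib_left)
    have "axis undefined 1 \<in> S"
      by (simp add: S_def axis_def)
    then show "S \<noteq> {}"
      by blast
    show "continuous_on S (\<lambda>x. x v* P)"
      unfolding transpose_matrix_vector[symmetric]
      by (intro linear_continuous_on matrix_vector_mul_bounded_linear)
    show "(\<lambda>x. x v* P) \<in> S \<rightarrow> S"
    proof
      fix x assume x: "x \<in> S"
      have "(\<Sum>j\<in>UNIV. (x v* P) $ j) = (\<Sum>i\<in>UNIV. x $ i * (\<Sum>j\<in>UNIV. P $ i $ j))"
        unfolding vector_matrix_mult_def vec_lambda_beta sum_distrib_left
        by (subst sum.swap) (simp add: mult.commute)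
      then show "x v* P \<in> S"
        using x nonneg
        by (auto simp: S_def consensus_row_sum[OF P] vector_matrix_mult_def intro!: sum_nonneg)
    qed
  qed
  obtain u where u: "0 < x $ u"
  proof (rule ccontr)
    assume "\<not> thesis"
    then have "\<not> 0 < x $ u" for u
      using that by blast
    then have "x $ u = 0" for u
      using x(1) by (auto simp: S_def not_less intro!: antisym)
    then show False
      using x(1) by (simp add: S_def)
  qed
  have "v \<in> {v. 0 < x $ v}" for v
  proof (rule irreducible_closed_set[of P u])
    fix i j assume "i \<in> {v. 0 < x $ v}" "P $ i $ j \<noteq> 0"
    then have "0 < P $ i $ j * x $ i"
      using nonneg[of i j] by (simp add: less_le)
    also have "\<dots> \<le> (\<Sum>i\<in>UNIV. P $ i $ j * x $ i)"
      by (rule member_le_sum[of i UNIV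
          "\<lambda>i. P $ i $ j * x $ i"]) (use x(1) nonneg in \<open>auto simp: S_def\<close>)
    also have "\<dots> = x $ j"
      by (subst (2) x(2)[symmetric]) (simp add: vector_matrix_mult_def mult.commute)
    finally show "j \<in> {v. 0 < x $ v}" by simp
  qed (use P u in \<open>auto simp: consensus_matrix_def\<close>)
  then show ?thesis
    using x unfolding is_invariant_measure_def S_def by auto
qed

text \<open>
  The ratio of two invariant measures is harmonic for the reversed chain: its value at \<open>j\<close>
  is an average of its values at the predecessors \<open>i\<close> of \<open>j\<close>. By the maximum principle the
  set where it is maximal is closed under predecessors, hence the ratio is constant, and the
  normalisation makes it \<open>1\<close>.
\<close>

lemma invariant_measure_unique:
  fixes P :: "real ^ 'n ^ 'n"
  assumes P: "consensus_matrix P" and \<pi>: "is_invariant_measure P \<pi>" and \<rho>: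
      "is_invariant_measure P \<rho>"
  shows "\<rho> = \<pi>"
proof -
  have pos: "0 < \<pi> $ u" for u
    using \<pi> by (simp add: is_invariant_measure_def)
  define h where "h u = \<rho> $ u / \<pi> $ u" for u
  define m where "m = Max (range h)"
  have le: "h u \<le> m" for u
    unfolding m_def by simp
  have "m \<in> range h"
    unfolding m_def by (rule Max_in) auto
  then obtain v0 where v0: "h v0 = m"
    by auto
  have \<rho>h: "\<rho> $ u = h u * \<pi> $ u" for u
    using pos[of u] by (simp add: h_def)
  \<comment> \<open>If the average at \<open>j\<close> equals the maximum, so does each term that carries positive weight.\<close>
  have step: "h i = m" if "P $ i $ j \<noteq> 0" "h j = m" for i j
  proof -
    have "(\<Sum>i\<in>UNIV. \<pi> $ i * P $ i $ j * (m - h i))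
        = m * (\<Sum>i\<in>UNIV. \<pi> $ i * P $ i $ j) - (\<Sum>i\<in>UNIV. \<rho> $ i * P $ i $ j)"
      unfolding sum_distrib_left sum_subtractf[symmetric] \<rho>h
      by (intro sum.cong refl) (simp add: algebra_simps)
    also have "\<dots> = 0"
      using is_invariant_measure_column_sum[OF \<pi>] is_invariant_measure_column_sum[OF \<rho>] \<rho>h that(2)
      by simp
    finally have "(\<Sum>i\<in>UNIV. \<pi> $ i * P $ i $ j * (m - h i)) = 0" .
    moreover have "0 \<le> \<pi> $ i * P $ i $ j * (m - h i)" for i
      using P less_imp_le[OF pos[of i]] le[of i] by (simp add: consensus_matrix_def)
    ultimately have "\<pi> $ i * P $ i $ j * (m - h i) = 0"
      by (simp add: sum_nonneg_eq_0_iff)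
    then show ?thesis
      using that(1) pos[of i] by simp
  qed
  have h: "h u = m" for u
  proof (rule ccontr)
    assume "h u \<noteq> m"
    have "v0 \<in> {u. h u \<noteq> m}"
    proof (rule irreducible_closed_set)
      show "irreducible_matrix P"
        using P by (simp add: consensus_matrix_def)
      show "u \<in> {u. h u \<noteq> m}"
        using \<open>h u \<noteq> m\<close> by simp
      show "j \<in> {u. h u \<noteq> m}" if "i \<in> {u. h u \<noteq> m}" "P $ i $ j \<noteq> 0" for i j
        using that step[of i j] by blast
    qed
    then show False
      using v0 by simp
  qed
  have "1 = (\<Sum>u\<in>UNIV. \<rho> $ u)"
    using \<rho> by (simp add: is_invariant_measure_def)
  also have "\<dots> = m"
    using \<pi> by (simp add: \<rho>h h is_invariant_measure_def flip: sum_distrib_left)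
  finally show ?thesis
    by (simp add: vec_eq_iff \<rho>h h)
qed

lemma is_invariant_measure_invariant_measure:
  assumes "consensus_matrix P"
  shows "is_invariant_measure P (invariant_measure P)"
  unfolding invariant_measure_def
  by (rule theI') (metis assms invariant_measure_exists invariant_measure_unique)

section \<open>Laplacians and effective resistance\<close>

lemma laplacian_mult_vec: "(laplacian C *v x) $ u = (\<Sum>v\<in>UNIV. C $ u $ v * (x $ u - x $ v))"
  for C :: "real ^ 'n ^ 'n"
proof -
  have "diag_matrix d *v x = (\<chi> u. d $ u * x $ u)" for d :: "real ^ 'n"
    by (simp add: vec_eq_iff matrix_vector_mult_def diag_matrix_def mult_delta_left)
  then have "(laplacian C *v x) $ u = (C *v 1) $ u * x $ u - (C *v x) $ u"
    by (simp add: laplacian_def matrix_vector_mult_diff_rdistrib)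
  also have "\<dots> = (\<Sum>v\<in>UNIV. C $ u $ v * (x $ u - x $ v))"
    by (simp add: matrix_vector_mult_def right_diff_distrib sum_subtractf sum_distrib_right)
  finally show ?thesis .
qed

lemma laplacian_quadratic_form:
  fixes C :: "real ^ 'n ^ 'n"
  assumes "transpose C = C"
  shows "2 * (x \<bullet> (laplacian C *v x)) = (\<Sum>u\<in>UNIV. \<Sum>v\<in>UNIV. C $ u $ v * (x $ u - x $ v)\<^sup>2)"
proof -
  have C: "C $ v $ u = C $ u $ v" for u v
    using assms by (metis transpose_def vec_lambda_beta)
  have 1: "x \<bullet> (laplacian C *v x) = (\<Sum>u\<in>UNIV. \<Sum>v\<in>UNIV. x $ u * (C $ u $ v * (x $ u - x $ v)))"
    by (simp add: inner_vec_def laplacian_mult_vec sum_distrib_left)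
  also have "\<dots> = (\<Sum>u\<in>UNIV. \<Sum>v\<in>UNIV. x $ v * (C $ v $ u * (x $ v - x $ u)))"
    by (rule sum.swap)
  finally have 2:
      "x \<bullet> (laplacian C *v x) = (\<Sum>u\<in>UNIV. \<Sum>v\<in>UNIV. x $ v * (C $ u $ v * (x $ v - x $ u)))"
    by (simp only: C)
  have "2 * (x \<bullet> (laplacian C *v x)) = x \<bullet> (laplacian C *v x) + x \<bullet> (laplacian C *v x)"
    by simp
  also have "\<dots>
      = (\<Sum>u\<in>UNIV. \<Sum>v\<in>UNIV. x $ u * (C $ u $ v * (x $ u - x $ v)) + x $ v * (C $ u $ v * (x $ v
          - x $ u)))"
    by (simp only: sum.distrib 1[symmetric] 2[symmetric])
  also have "\<dots> = (\<Sum>u\<in>UNIV. \<Sum>v\<in>UNIV. C $ u $ v * (x $ u - x $ v)\<^sup>2)"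
    by (intro sum.cong refl) (simp add: power2_eq_square algebra_simps)
  finally show ?thesis .
qed

lemma laplacian_nonneg:
  assumes "conductance_matrix C"
  shows "0 \<le> x \<bullet> (laplacian C *v x)"
proof -
  have "0 \<le> 2 * (x \<bullet> (laplacian C *v x))"
    using assms unfolding conductance_matrix_def
    by (subst laplacian_quadratic_form) (auto intro!: sum_nonneg)
  then show ?thesis by simp
qed

text \<open>
  A vanishing Dirichlet energy forces equal values across each edge.
\<close>

lemma laplacian_kernel_constant:
  fixes C :: "real ^ 'n ^ 'n"
  assumes C: "conductance_matrix C" and x: "x \<bullet> (laplacian C *v x) = 0"
  shows "x $ a = x $ b"
proof -
  have nonneg: "0 \<le> C $ u $ v * (x $ u - x $ v)\<^sup>2" for u v
    using C by (simp add: conductance_matrix_def)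
  have "(\<Sum>u\<in>UNIV. \<Sum>v\<in>UNIV. C $ u $ v * (x $ u - x $ v)\<^sup>2) = 0"
    using x C by (subst laplacian_quadratic_form[symmetric]) (auto simp: conductance_matrix_def)
  then have zero: "C $ u $ v * (x $ u - x $ v)\<^sup>2 = 0" for u v
    by (simp add: sum_nonneg_eq_0_iff sum_nonneg nonneg)
  have "a \<in> {u. x $ u = x $ b}"
  proof (rule irreducible_closed_set)
    show "irreducible_matrix C"
      using C by (simp add: conductance_matrix_def)
    fix u v assume "u \<in> {u. x $ u = x $ b}" "C $ u $ v \<noteq> 0"
    then show "v \<in> {u. x $ u = x $ b}"
      using zero[of u v] by simp
  qed simp
  then show ?thesis by simp
qed

text \<open>
  Two solutions of the Laplace equation differ by a kernel element, which is constant, so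
  any solution gives the potential difference that the definition takes from a chosen one.
\<close>

lemma effective_resistance_eq:
  fixes C :: "real ^ 'n ^ 'n"
  assumes C: "conductance_matrix C" and x: "laplacian C *v x = axis a 1 - axis b 1"
  shows "effective_resistance C a b = x $ a - x $ b"
proof -
  define y where "y = (SOME y. laplacian C *v y = axis a 1 - axis b 1)"
  have y: "laplacian C *v y = axis a 1 - axis b 1"
    unfolding y_def by (rule someI) (rule x)
  have "laplacian C *v (y - x) = 0"
    by (simp add: matrix_vector_mult_diff_distrib x y)
  then have "(y - x) $ a = (y - x) $ b"
    by (intro laplacian_kernel_constant[OF C]) simp
  then show ?thesis
    unfolding effective_resistance_def y_def[symmetric]
    by (simp add: inner_diff_left inner_axis' algebra_simps)
qed

lemma effective_resistance_nonneg:
  fixes C :: "real ^ 'n ^ 'n"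
  assumes C: "conductance_matrix C" and x: "laplacian C *v x = axis a 1 - axis b 1"
  shows "0 \<le> effective_resistance C a b"
  using laplacian_nonneg[OF C, of x]
  unfolding effective_resistance_eq[OF assms] x by (simp add: inner_diff_right inner_axis)

section \<open>The centred chain and its resistances\<close>

text \<open>
  Conjugation by the square root of \<open>diag_matrix \<pi>\<close>. It turns the adjoint with respect to
  the inner product weighted by \<open>\<pi>\<close> into the transpose.
\<close>

definition rescale :: "real ^ 'n \<Rightarrow> real ^ 'n ^ 'n \<Rightarrow> real ^ 'n ^ 'n" where
  "rescale \<pi> A = (\<chi> i j. sqrt (\<pi> $ i) * A $ i $ j / sqrt (\<pi> $ j))"

lemma rescale_mult:
  assumes "\<And>u. 0 < \<pi> $ u"
  shows "rescale \<pi> (A ** B) = rescale \<pi> A ** rescale \<pi> B"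
proof -
  have "sqrt (\<pi> $ k) \<noteq> 0" for k
    using assms[of k] by simp
  then show ?thesis
    by (simp add: vec_eq_iff rescale_def matrix_matrix_mult_def sum_distrib_left sum_divide_distrib)
qed

lemma rescale_mat_1:
  assumes "\<And>u. 0 < \<pi> $ u"
  shows "rescale \<pi> (mat 1) = mat 1"
  using assms by (auto simp: vec_eq_iff rescale_def mat_def less_imp_neq[symmetric])

lemma matrix_power_rescale:
  assumes "\<And>u. 0 < \<pi> $ u"
  shows "matrix_power (rescale \<pi> A) t = rescale \<pi> (matrix_power A t)"
  by (induction t) (simp_all add: rescale_mat_1[OF assms] rescale_mult[OF assms])

locale consensus_chain =
  fixes P :: "real ^ 'n ^ 'n" and \<pi> :: "real ^ 'n" and n :: real
  assumes P: "consensus_matrix P" and \<pi>: "is_invariant_measure P \<pi>" and n: "n = real CARD('n)"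
begin

definition deviation :: "nat \<Rightarrow> real ^ 'n ^ 'n" where
  "deviation t = matrix_power P t - outer 1 \<pi>"

text \<open>
  Removing the projection onto \<open>root\<pi>\<close>, the image of the constants, from the rescaled chain
  adds this projection to the rescaled Laplacian (\<open>defect_nth\<close>) and so makes it invertible;
  \<open>green\<close> is the inverse.
\<close>

definition centred :: "real ^ 'n ^ 'n" where
  "centred = rescale \<pi> (P - outer 1 \<pi>)"

definition conductance :: "real ^ 'n ^ 'n" where
  "conductance = n *\<^sub>R (transpose P ** diag_matrix \<pi> ** P)"

definition root\<pi> :: "real ^ 'n" where
  "root\<pi> = (\<chi> u. sqrt (\<pi> $ u))"

definition green :: "real ^ 'n ^ 'n" where
  "green = matrix_inv (defect centred)"

lemma nonneg: "0 \<le> P $ u $ v"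
  using P by (simp add: consensus_matrix_def)

lemma pos: "0 < \<pi> $ u"
  using \<pi> by (simp add: is_invariant_measure_def)

lemma sum_\<pi>: "(\<Sum>u\<in>UNIV. \<pi> $ u) = 1"
  using \<pi> by (simp add: is_invariant_measure_def)

lemma row_sum: "(\<Sum>j\<in>UNIV. P $ i $ j) = 1"
  by (rule consensus_row_sum[OF P])

lemma column_sum: "(\<Sum>i\<in>UNIV. \<pi> $ i * P $ i $ j) = \<pi> $ j"
  by (rule is_invariant_measure_column_sum[OF \<pi>])

lemma root\<pi>_pos: "0 < root\<pi> $ u"
  by (simp add: root\<pi>_def pos)

lemma root\<pi>_sq: "root\<pi> $ u * root\<pi> $ u = \<pi> $ u"
  by (simp add: root\<pi>_def pos less_imp_le)

lemma n_pos: "0 < n"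
  by (simp add: n)

lemma n_nz [simp]: "n \<noteq> 0"
  using n_pos by simp

lemma rescale_nth: "rescale \<pi> A $ i $ j = root\<pi> $ i * A $ i $ j / root\<pi> $ j"
  by (simp add: rescale_def root\<pi>_def)

lemma conductance_nth: "conductance $ u $ v = n * (\<Sum>k\<in>UNIV. \<pi> $ k * P $ k $ u * P $ k $ v)"
  unfolding conductance_def matrix_mul_assoc[symmetric]
  by (simp add: matrix_matrix_mult_def[of "transpose P"] diag_matrix_mult)
     (simp add: transpose_def mult_ac)

lemma conductance_sym: "conductance $ u $ v = conductance $ v $ u"
  by (simp add: conductance_nth mult_ac)

lemma conductance_mult_1: "(conductance *v 1) $ u = n * \<pi> $ u"
proof -
  have "(conductance *v 1) $ u = n * (\<Sum>v\<in>UNIV. \<Sum>k\<in>UNIV. \<pi> $ k * P $ k $ u * P $ k $ v)"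
    by (simp add: matrix_vector_mult_def conductance_nth sum_distrib_left)
  also have "\<dots> = n * (\<Sum>k\<in>UNIV. \<pi> $ k * P $ k $ u * (\<Sum>v\<in>UNIV. P $ k $ v))"
    by (subst sum.swap) (simp add: sum_distrib_left)
  finally show ?thesis
    by (simp add: row_sum column_sum)
qed

lemma conductance_ge: "n * (\<pi> $ k * P $ k $ u * P $ k $ v) \<le> conductance $ u $ v"
  unfolding conductance_nth
  by (intro mult_left_mono member_le_sum[of k UNIV "\<lambda>k. \<pi> $ k * P $ k $ u * P $ k $ v"])
     (simp_all add: nonneg pos n_pos less_imp_le)

text \<open>
  Because the diagonal of \<open>P\<close> is positive, the path \<open>i \<rightarrow> i\<close>, \<open>i \<rightarrow> j\<close> shows that each edge of
  \<open>P\<close> is an edge of the conductance matrix.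
\<close>

lemma conductance_matrix_conductance: "conductance_matrix conductance"
  unfolding conductance_matrix_def
proof (intro conjI allI)
  show "transpose conductance = conductance"
    by (simp add: vec_eq_iff transpose_def conductance_sym)
  show "0 \<le> conductance $ u $ v" for u v
    unfolding conductance_nth
    by (intro mult_nonneg_nonneg sum_nonneg) (simp_all add: nonneg pos n_pos less_imp_le)
  show "irreducible_matrix conductance"
    unfolding irreducible_matrix_def
  proof (intro allI)
    fix u v
    have "conductance $ i $ j \<noteq> 0" if "P $ i $ j \<noteq> 0" for i j
    proof -
      have "0 < P $ i $ i" "0 < P $ i $ j"
        using P that nonneg[of i j] by (auto simp: consensus_matrix_def less_le)
      then have "0 < n * (\<pi> $ i * P $ i $ i * P $ i $ j)"
        using pos[of i] n_pos by simp
      then show ?thesis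
        using conductance_ge[of i i j] by simp
    qed
    then have "{(i, j). P $ i $ j \<noteq> 0} \<subseteq> {(i, j). conductance $ i $ j \<noteq> 0}"
      by auto
    moreover have "(u, v) \<in> {(i, j). P $ i $ j \<noteq> 0}\<^sup>*"
      using P by (simp add: consensus_matrix_def irreducible_matrix_def)
    ultimately show "(u, v) \<in> {(i, j). conductance $ i $ j \<noteq> 0}\<^sup>*"
      using rtrancl_mono by blast
  qed
qed

lemma laplacian_conductance_nth:
  "laplacian conductance $ u $ v = (if u = v then n * \<pi> $ u else 0) - conductance $ u $ v"
  by (simp add: laplacian_def diag_matrix_def conductance_mult_1)

lemma centred_gram_nth:
  "(transpose centred ** centred) $ u $ v
      = (conductance $ u $ v / n - \<pi> $ u * \<pi> $ v) / (root\<pi> $ u * root\<pi> $ v)"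
proof -
  have "(transpose centred ** centred) $ u $ v
      = (\<Sum>k\<in>UNIV. (root\<pi> $ k * (P $ k $ u - \<pi> $ u) / root\<pi> $ u) * (root\<pi> $ k * (P $ k $ v
          - \<pi> $ v) / root\<pi> $ v))"
    by (simp add: centred_def matrix_matrix_mult_def transpose_def rescale_nth outer_def)
  also have "\<dots>
      = (\<Sum>k\<in>UNIV. (root\<pi> $ k * root\<pi> $ k) * (P $ k $ u - \<pi> $ u) * (P $ k $ v
          - \<pi> $ v)) / (root\<pi> $ u * root\<pi> $ v)"
    unfolding sum_divide_distrib by (intro sum.cong refl) (simp add: mult_ac)
  also have "(\<Sum>k\<in>UNIV. (root\<pi> $ k * root\<pi> $ k) * (P $ k $ u - \<pi> $ u) * (P $ k $ v - \<pi> $ v))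
      = (\<Sum>k\<in>UNIV. \<pi> $ k * P $ k $ u * P $ k $ v - \<pi> $ v * (\<pi> $ k * P $ k $ u)
          - \<pi> $ u * (\<pi> $ k * P $ k $ v) + \<pi> $ u * \<pi> $ v * \<pi> $ k)"
    unfolding root\<pi>_sq by (intro sum.cong refl) (simp add: algebra_simps)
  also have "\<dots> = conductance $ u $ v / n - \<pi> $ u * \<pi> $ v"
    by (simp add: sum.distrib sum_subtractf column_sum sum_\<pi> conductance_nth flip: sum_distrib_left)
  finally show ?thesis .
qed

text \<open>
  The bridge between contraction and network: the defect is the conjugated Laplacian plus
  the rank one correction.
\<close>

lemma defect_nth:
  "root\<pi> $ u * defect centred $ u $ v * root\<pi> $ v
      = laplacian conductance $ u $ v / n + \<pi> $ u * \<pi> $ v"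
proof -
  have "root\<pi> $ u \<noteq> 0" "root\<pi> $ v \<noteq> 0"
    using root\<pi>_pos[of u] root\<pi>_pos[of v] by simp_all
  then have "root\<pi> $ u * (transpose centred ** centred) $ u $ v * root\<pi> $ v
      = conductance $ u $ v / n - \<pi> $ u * \<pi> $ v"
    unfolding centred_gram_nth by simp
  moreover have
      "root\<pi> $ u * (mat 1 :: real ^ 'n ^ 'n) $ u $ v * root\<pi> $ v = (if u = v then \<pi> $ u else 0)"
    by (simp add: mat_def root\<pi>_sq)
  moreover have
      "laplacian conductance $ u $ v / n = (if u = v then \<pi> $ u else 0) - conductance $ u $ v / n"
    by (simp add: laplacian_conductance_nth diff_divide_distrib)
  ultimately show ?thesis
    by (simp only: vector_minus_component right_diff_distrib left_diff_distrib)
qed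

text \<open>
  With \<open>y = \<surd>\<Pi> x\<close>, the difference \<open>norm y\<^sup>2 - norm (T y)\<^sup>2\<close> is the Dirichlet energy of \<open>x\<close>
  over \<open>n\<close> plus \<open>(\<pi> \<bullet> x)\<^sup>2\<close>. The first vanishes only for constants, and on nonzero constants
  the second does not.
\<close>

lemma strict_contraction_centred: "strict_contraction centred"
  unfolding strict_contraction_def
proof (intro allI impI)
  fix y :: "real ^ 'n" assume "y \<noteq> 0"
  define x where "x = (\<chi> u. y $ u / root\<pi> $ u)"
  have y: "y $ u = root\<pi> $ u * x $ u" for u
    using root\<pi>_pos[of u] by (simp add: x_def)
  have "y \<bullet> (defect centred *v y)
      = (\<Sum>u\<in>UNIV. \<Sum>v\<in>UNIV. x $ u * x $ v * (root\<pi> $ u * defect centred $ u $ v * root\<pi> $ v))"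
    by (simp only: inner_vec_def inner_real_def matrix_vector_mult_def vec_lambda_beta y
        sum_distrib_left mult_ac)
  also have "\<dots>
      = (\<Sum>u\<in>UNIV. \<Sum>v\<in>UNIV. x $ u * (laplacian conductance $ u $ v * x $ v) / n
          + (\<pi> $ u * x $ u) * (\<pi> $ v * x $ v))"
    unfolding defect_nth by (intro sum.cong refl) (simp add: algebra_simps)
  also have "\<dots> = (x \<bullet> (laplacian conductance *v x)) / n + (\<pi> \<bullet> x)\<^sup>2"
  proof -
    have "(\<pi> \<bullet> x)\<^sup>2 = (\<Sum>u\<in>UNIV. \<Sum>v\<in>UNIV. (\<pi> $ u * x $ u) * (\<pi> $ v * x $ v))"
      by (simp add: inner_vec_def power2_eq_square sum_product)
    then show ?thesis
      by (simp add: sum.distrib inner_vec_def matrix_vector_mult_def sum_divide_distrib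
          sum_distrib_left)
  qed
  finally have form:
      "y \<bullet> (defect centred *v y) = (x \<bullet> (laplacian conductance *v x)) / n + (\<pi> \<bullet> x)\<^sup>2" .
  have "0 < (x \<bullet> (laplacian conductance *v x)) / n + (\<pi> \<bullet> x)\<^sup>2"
  proof (rule ccontr)
    assume "\<not> ?thesis"
    moreover have "0 \<le> (x \<bullet> (laplacian conductance *v x)) / n"
      by (intro divide_nonneg_pos laplacian_nonneg conductance_matrix_conductance n_pos)
    ultimately have zero: "(x \<bullet> (laplacian conductance *v x)) / n = 0" "(\<pi> \<bullet> x)\<^sup>2 = 0"
      using zero_le_power2[of "\<pi> \<bullet> x"] by linarith+
    define c where "c = x $ undefined"
    have c: "x $ u = c" for u
      unfolding c_def using zero(1)
      by (intro laplacian_kernel_constant[OF conductance_matrix_conductance]) simp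
    have "\<pi> \<bullet> x = c"
      by (simp add: inner_vec_def c sum_\<pi> flip: sum_distrib_right)
    then have "y = 0"
      using zero(2) by (simp add: vec_eq_iff y c)
    then show False
      using \<open>y \<noteq> 0\<close> by simp
  qed
  moreover have "y \<bullet> (defect centred *v y) = (norm y)\<^sup>2 - (norm (centred *v y))\<^sup>2"
  proof -
    have "y \<bullet> ((transpose centred ** centred) *v y) = (centred *v y) \<bullet> (centred *v y)"
      by (simp only: matrix_vector_mul_assoc[symmetric] transpose_matrix_vector
          dot_lmul_matrix[symmetric] inner_commute[of y])
    then show ?thesis
      unfolding power2_norm_eq_inner
      by (simp only: matrix_vector_mult_diff_rdistrib inner_diff_right matrix_vector_mul_lid)
  qed
  ultimately show "norm (centred *v y) < norm y"
    using form by (intro power2_less_imp_less[of _ "norm y"]) simp_all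
qed

lemma defect_inverse: "defect centred ** green = mat 1" "green ** defect centred = mat 1"
  unfolding green_def
  by (simp_all add: matrix_inv_mult[OF invertible_defect[OF strict_contraction_centred]])

lemma transpose_green: "transpose green = green"
proof -
  have "transpose green ** defect centred = transpose (defect centred ** green)"
    by (simp only: matrix_transpose_mul transpose_defect)
  also have "\<dots> = mat 1"
    by (simp add: defect_inverse(1))
  finally have "transpose green ** (defect centred ** green) = green"
    by (simp add: matrix_mul_assoc)
  then show ?thesis
    by (simp add: defect_inverse(1))
qed

lemma green_mult_root\<pi>: "green *v root\<pi> = root\<pi>"
proof -
  have "root\<pi> $ v \<noteq> 0" for v
    using root\<pi>_pos[of v] by simp
  then have "centred *v root\<pi> = 0"
    by (simp add: vec_eq_iff matrix_vector_mult_def centred_def rescale_nth outer_def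
        right_diff_distrib sum_subtractf row_sum sum_\<pi> flip: sum_distrib_left)
  then have "defect centred *v root\<pi> = root\<pi>"
    by (simp add: matrix_vector_mult_diff_rdistrib matrix_vector_mul_assoc[symmetric] del:
        transpose_matrix_vector)
  then have "green *v root\<pi> = (green ** defect centred) *v root\<pi>"
    by (simp only: matrix_vector_mul_assoc[symmetric])
  then show ?thesis
    by (simp only: defect_inverse(2) matrix_vector_mul_lid)
qed

lemma green_column_sum: "(\<Sum>j\<in>UNIV. root\<pi> $ j * green $ j $ a) = root\<pi> $ a"
proof -
  have "green $ j $ a = green $ a $ j" for j
    using arg_cong[OF transpose_green, of "\<lambda>M. M $ a $ j"] by (simp add: transpose_def)
  then have "(\<Sum>j\<in>UNIV. root\<pi> $ j * green $ j $ a) = (green *v root\<pi>) $ a"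
    by (simp add: matrix_vector_mult_def mult.commute)
  then show ?thesis
    by (simp only: green_mult_root\<pi>)
qed

text \<open>
  The column difference of the generalised inverse \<open>\<Pi>\<^sup>-\<^sup>1\<^sup>/\<^sup>2 Y \<Pi>\<^sup>-\<^sup>1\<^sup>/\<^sup>2 / n\<close> of the
  Laplacian; \<open>laplacian_potential\<close> shows that it solves the Laplace equation for a unit
  current from \<open>a\<close> to \<open>b\<close>.
\<close>

definition potential :: "'n \<Rightarrow> 'n \<Rightarrow> real ^ 'n" where
  "potential a b = (\<chi> j. (green $ j $ a / root\<pi> $ a - green $ j $ b / root\<pi> $ b) / (n * root\<pi> $ j))"

lemma laplacian_potential: "laplacian conductance *v potential a b = axis a 1 - axis b 1"
proof -
  define g where "g j = green $ j $ a / root\<pi> $ a - green $ j $ b / root\<pi> $ b" for j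
  define N where "N = defect centred"
  have s0: "root\<pi> $ j \<noteq> 0" for j
    using root\<pi>_pos[of j] by simp
  have NY: "(\<Sum>j\<in>UNIV. N $ i $ j * green $ j $ k) = (if i = k then 1 else 0)" for i k
    using arg_cong[OF defect_inverse(1), of "\<lambda>M. M $ i $ k"]
    by (simp add: N_def matrix_matrix_mult_def mat_def)
  have g0: "(\<Sum>j\<in>UNIV. root\<pi> $ j * g j) = 0"
  proof -
    have "(\<Sum>j\<in>UNIV. root\<pi> $ j * g j)
        = (\<Sum>j\<in>UNIV. root\<pi> $ j * green $ j $ a) / root\<pi> $ a
            - (\<Sum>j\<in>UNIV. root\<pi> $ j * green $ j $ b) / root\<pi> $ b"
      unfolding g_def sum_divide_distrib sum_subtractf[symmetric]
      by (intro sum.cong refl) (simp add: right_diff_distrib)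
    then show ?thesis
      by (simp add: green_column_sum s0)
  qed
  have Ng: "(\<Sum>j\<in>UNIV. N $ i $ j * g j)
      = (if i = a then 1 else 0) / root\<pi> $ a - (if i = b then 1 else 0) / root\<pi> $ b" for i
  proof -
    have "(\<Sum>j\<in>UNIV. N $ i $ j * g j)
        = (\<Sum>j\<in>UNIV. N $ i $ j * green $ j $ a) / root\<pi> $ a
            - (\<Sum>j\<in>UNIV. N $ i $ j * green $ j $ b) / root\<pi> $ b"
      unfolding g_def sum_divide_distrib sum_subtractf[symmetric]
      by (intro sum.cong refl) (simp add: right_diff_distrib)
    then show ?thesis
      by (simp only: NY)
  qed
  show ?thesis
    unfolding vec_eq_iff
  proof
    fix i
    have "(laplacian conductance *v potential a b) $ i
        = (\<Sum>j\<in>UNIV. laplacian conductance $ i $ j * (g j / (n * root\<pi> $ j)))"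
      by (simp add: matrix_vector_mult_def potential_def g_def)
    also have "\<dots> = (\<Sum>j\<in>UNIV. root\<pi> $ i * (N $ i $ j * g j) - \<pi> $ i * (root\<pi> $ j * g j))"
    proof (intro sum.cong refl)
      fix j
      have L: "laplacian conductance $ i $ j
          = n * (root\<pi> $ i * N $ i $ j * root\<pi> $ j - \<pi> $ i * (root\<pi> $ j * root\<pi> $ j))"
        using defect_nth[of i j] by (simp add: N_def root\<pi>_sq field_simps)
      show "laplacian conductance $ i $ j * (g j / (n * root\<pi> $ j))
          = root\<pi> $ i * (N $ i $ j * g j) - \<pi> $ i * (root\<pi> $ j * g j)"
        unfolding L using s0[of j] by (simp add: field_simps)
    qed
    also have "\<dots> = root\<pi> $ i * (\<Sum>j\<in>UNIV. N $ i $ j * g j) - \<pi> $ i * (\<Sum>j\<in>UNIV. root\<pi> $ j * g j)"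
      by (simp only: sum_subtractf sum_distrib_left)
    also have "\<dots> = (axis a 1 - axis b 1) $ i"
      unfolding Ng g0 using s0[of i] by (auto simp: axis_def)
    finally show "(laplacian conductance *v potential a b) $ i = (axis a 1 - axis b 1) $ i" .
  qed
qed

lemma effective_resistance_conductance:
  "effective_resistance conductance a b
    = (green $ a $ a / \<pi> $ a + green $ b $ b / \<pi> $ b - (green $ a $ b
        + green $ b $ a) / (root\<pi> $ a * root\<pi> $ b)) / n"
proof -
  have "root\<pi> $ a \<noteq> 0" "root\<pi> $ b \<noteq> 0"
    using root\<pi>_pos[of a] root\<pi>_pos[of b] by simp_all
  then show ?thesis
    unfolding effective_resistance_eq[OF conductance_matrix_conductance laplacian_potential]
    by (simp add: potential_def diff_divide_distrib add_divide_distrib mult_ac flip: root\<pi>_sq)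
qed

text \<open>
  In the double sum the diagonal entries of \<open>Y\<close> collect to \<open>2 * trace Y\<close>, while the
  off-diagonal ones collect to \<open>2 * (\<surd>\<pi> \<bullet> Y \<surd>\<pi>) = 2\<close>.
\<close>

lemma trace_green:
  "2 * (trace green - 1)
      = n * (\<Sum>a\<in>UNIV. \<Sum>b\<in>UNIV. \<pi> $ a * \<pi> $ b * effective_resistance conductance a b)"
proof -
  have s0: "root\<pi> $ j \<noteq> 0" for j
    using root\<pi>_pos[of j] by simp
  have "n * (\<Sum>a\<in>UNIV. \<Sum>b\<in>UNIV. \<pi> $ a * \<pi> $ b * effective_resistance conductance a b)
      = (\<Sum>a\<in>UNIV. \<Sum>b\<in>UNIV. \<pi> $ b * green $ a $ a + \<pi> $ a * green $ b $ b
          - root\<pi> $ a * (root\<pi> $ b * green $ b $ a) - root\<pi> $ b * (root\<pi> $ a * green $ a $ b))"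
    unfolding sum_distrib_left effective_resistance_conductance
  proof (intro sum.cong refl)
    fix a b
    show "n * (\<pi> $ a * \<pi> $ b * ((green $ a $ a / \<pi> $ a + green $ b $ b / \<pi> $ b - (green $ a $ b
        + green $ b $ a) / (root\<pi> $ a * root\<pi> $ b)) / n))
        = \<pi> $ b * green $ a $ a + \<pi> $ a * green $ b $ b - root\<pi> $ a * (root\<pi> $ b * green $ b $ a)
            - root\<pi> $ b * (root\<pi> $ a * green $ a $ b)"
      using s0[of a] s0[of b] by (simp add: field_simps flip: root\<pi>_sq)
  qed
  also have "\<dots>
      = (\<Sum>a\<in>UNIV. green $ a $ a + \<pi> $ a * trace green - root\<pi> $ a * root\<pi> $ a)
          - (\<Sum>b\<in>UNIV. root\<pi> $ b * root\<pi> $ b)"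
  proof -
    have "(\<Sum>a\<in>UNIV. \<Sum>b\<in>UNIV. root\<pi> $ b * (root\<pi> $ a * green $ a $ b))
        = (\<Sum>b\<in>UNIV. root\<pi> $ b * root\<pi> $ b)"
      by (subst sum.swap) (simp add: green_column_sum flip: sum_distrib_left)
    moreover have "(\<Sum>b\<in>UNIV. root\<pi> $ a * (root\<pi> $ b * green $ b $ a)) = root\<pi> $ a * root\<pi> $ a"
        "(\<Sum>b\<in>UNIV. \<pi> $ b * green $ a $ a) = green $ a $ a"
            "(\<Sum>b\<in>UNIV. \<pi> $ a * green $ b $ b) = \<pi> $ a * trace green" for a
      by (simp_all add: green_column_sum trace_def sum_\<pi> flip: sum_distrib_left sum_distrib_right)
    ultimately show ?thesis
      by (simp only: sum_subtractf sum.distrib)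
  qed
  also have "\<dots> = 2 * (trace green - 1)"
    by (simp add: root\<pi>_sq sum_subtractf sum.distrib sum_\<pi>
        flip: sum_distrib_right) (simp add: trace_def)
  finally show ?thesis by simp
qed

lemma trace_green_le:
  assumes "\<And>u. \<pi> $ u \<le> M"
  shows "trace green - 1 \<le> M\<^sup>2 * n ^ 3 * avg_effective_resistance conductance"
proof -
  have "(\<Sum>a\<in>UNIV. \<Sum>b\<in>UNIV. \<pi> $ a * \<pi> $ b * effective_resistance conductance a b)
      \<le> (\<Sum>a\<in>UNIV. \<Sum>b\<in>UNIV. M\<^sup>2 * effective_resistance conductance a b)"
    unfolding power2_eq_square
    by (intro sum_mono mult_right_mono mult_mono assms effective_resistance_nonneg[OF
        conductance_matrix_conductance laplacian_potential])
       (simp_all add: pos less_imp_le order.trans[OF less_imp_le[OF pos] assms])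
  from mult_left_mono[OF this less_imp_le[OF n_pos]] have
      "2 * (trace green - 1) \<le> n * (M\<^sup>2 * (\<Sum>a\<in>UNIV. \<Sum>b\<in>UNIV. effective_resistance conductance a b))"
    unfolding trace_green by (simp add: sum_distrib_left)
  then show ?thesis
    using n_pos
    by (simp add: avg_effective_resistance_def power2_eq_square power3_eq_cube field_simps flip: n)
qed

lemma trace_green_ge:
  assumes "\<And>u. m \<le> \<pi> $ u" and "0 \<le> m"
  shows "m\<^sup>2 * n ^ 3 * avg_effective_resistance conductance \<le> trace green - 1"
proof -
  have "(\<Sum>a\<in>UNIV. \<Sum>b\<in>UNIV. m\<^sup>2 * effective_resistance conductance a b)
      \<le> (\<Sum>a\<in>UNIV. \<Sum>b\<in>UNIV. \<pi> $ a * \<pi> $ b * effective_resistance conductance a b)"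
    unfolding power2_eq_square
    by (intro sum_mono mult_right_mono mult_mono assms effective_resistance_nonneg[OF
        conductance_matrix_conductance laplacian_potential])
       (simp_all add: pos less_imp_le)
  from mult_left_mono[OF this less_imp_le[OF n_pos]] have
      "n * (m\<^sup>2 * (\<Sum>a\<in>UNIV. \<Sum>b\<in>UNIV. effective_resistance conductance a b)) \<le> 2 * (trace green - 1)"
    unfolding trace_green by (simp add: sum_distrib_left)
  then show ?thesis
    using n_pos
    by (simp add: avg_effective_resistance_def power2_eq_square power3_eq_cube field_simps flip: n)
qed

section \<open>The LQ costs as traces\<close>

definition scaled_deviation :: "nat \<Rightarrow> real ^ 'n ^ 'n" where
  "scaled_deviation t = rescale \<pi> (deviation t)"

abbreviation deviation_gram :: "nat \<Rightarrow> real ^ 'n ^ 'n" where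
  "deviation_gram t \<equiv> transpose (scaled_deviation t) ** scaled_deviation t"

lemma invariant_measure_eq: "invariant_measure P = \<pi>"
  by (rule invariant_measure_unique[OF P \<pi> is_invariant_measure_invariant_measure[OF P]])

lemma mult_outer: "P ** outer 1 \<pi> = outer 1 \<pi>"
  by (simp add: vec_eq_iff matrix_matrix_mult_def outer_def row_sum flip: sum_distrib_right)

lemma outer_mult: "outer 1 \<pi> ** P = outer 1 \<pi>"
  by (simp add: vec_eq_iff matrix_matrix_mult_def outer_def column_sum)

lemma outer_outer: "outer 1 \<pi> ** outer 1 \<pi> = outer 1 \<pi>"
  by (simp add: vec_eq_iff matrix_matrix_mult_def outer_def sum_\<pi> flip: sum_distrib_right)

lemma power_outer: "matrix_power P t ** outer 1 \<pi> = outer 1 \<pi>"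
  by (induction t) (simp_all add: mult_outer flip: matrix_mul_assoc)

lemma outer_power: "outer 1 \<pi> ** matrix_power P t = outer 1 \<pi>"
  by (induction t) (simp_all add: outer_mult matrix_mul_assoc)

text \<open>
  The identity fails at exponent \<open>0\<close>, where the left side is the identity and the deviation
  is the projection \<open>mat 1 - outer 1 \<pi>\<close>; hence the correction term in
  \<open>gram_scaled_deviation\<close>.
\<close>

lemma matrix_power_deviation: "matrix_power (P - outer 1 \<pi>) (Suc t) = deviation (Suc t)"
proof (induction t)
  case (Suc t)
  have "matrix_power (P - outer 1 \<pi>) (Suc (Suc t)) = (P - outer 1 \<pi>) ** deviation (Suc t)"
    unfolding Suc[symmetric] by simp
  also have "\<dots> = P ** matrix_power P (Suc t) - P ** outer 1 \<pi>
      - (outer 1 \<pi> ** matrix_power P (Suc t) - outer 1 \<pi> ** outer 1 \<pi>)"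
    by (simp only: deviation_def matrix_diff_ldistrib matrix_diff_rdistrib)
        (simp add: algebra_simps)
  also have "\<dots> = deviation (Suc (Suc t))"
    unfolding outer_power outer_outer mult_outer by (simp add: deviation_def)
  finally show ?case .
qed (simp add: deviation_def)

lemma transpose_outer_root\<pi>: "transpose (outer root\<pi> root\<pi>) = outer root\<pi> root\<pi>"
  by (simp add: vec_eq_iff transpose_def outer_def mult.commute)

lemma outer_root\<pi>_idem: "outer root\<pi> root\<pi> ** outer root\<pi> root\<pi> = outer root\<pi> root\<pi>"
proof -
  have "(\<Sum>k\<in>UNIV. root\<pi> $ i * root\<pi> $ k * (root\<pi> $ k * root\<pi> $ j))
      = root\<pi> $ i * root\<pi> $ j * (\<Sum>k\<in>UNIV. root\<pi> $ k * root\<pi> $ k)" for i j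
    by (simp add: sum_distrib_left mult_ac)
  then show ?thesis
    by (simp add: vec_eq_iff matrix_matrix_mult_def outer_def root\<pi>_sq sum_\<pi>)
qed

lemma gram_scaled_deviation: "deviation_gram t
    = transpose (matrix_power centred t) ** matrix_power centred t
        - (if t = 0 then outer root\<pi> root\<pi> else 0)"
proof (cases t)
  case 0
  have "root\<pi> $ j \<noteq> 0" for j
    using root\<pi>_pos[of j] by simp
  then have "scaled_deviation 0 = mat 1 - outer root\<pi> root\<pi>"
    by (simp add: vec_eq_iff scaled_deviation_def deviation_def rescale_nth outer_def mat_def
        right_diff_distrib diff_divide_distrib flip: root\<pi>_sq)
  then have "transpose (scaled_deviation 0) ** scaled_deviation 0
      = (mat 1 - outer root\<pi> root\<pi>) ** (mat 1 - outer root\<pi> root\<pi>)"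
    by (simp add: transpose_diff transpose_outer_root\<pi>)
  also have "\<dots> = mat 1 - outer root\<pi> root\<pi>"
    by (simp add: matrix_diff_ldistrib matrix_diff_rdistrib outer_root\<pi>_idem)
  finally show ?thesis
    by (simp add: 0)
next
  case (Suc k)
  have "scaled_deviation (Suc k) = matrix_power centred (Suc k)"
    unfolding scaled_deviation_def centred_def matrix_power_rescale[OF pos] matrix_power_deviation
        ..
  then show ?thesis
    by (simp add: Suc)
qed

lemma gram_scaled_deviation_sums:
  "(\<lambda>t. deviation_gram t) sums (gramian centred - outer root\<pi> root\<pi>)"
  unfolding gram_scaled_deviation gramian_def
  by (intro sums_diff summable_sums summable_gramian strict_contraction_centred sums_single)

lemma gram_scaled_deviation_diag:
  "deviation_gram t $ i $ i = (\<Sum>k\<in>UNIV. (scaled_deviation t $ k $ i)\<^sup>2)"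
  by (simp add: matrix_matrix_mult_def transpose_def power2_eq_square)

lemma trace_gram_scaled_deviation:
  "trace (deviation_gram t) = (\<Sum>i\<in>UNIV. \<Sum>k\<in>UNIV. (scaled_deviation t $ k $ i)\<^sup>2)"
  by (simp add: trace_def gram_scaled_deviation_diag)

lemma trace_gram_scaled_deviation_sums:
  "(\<lambda>t. trace (deviation_gram t)) sums (trace (gramian centred) - 1)"
proof -
  have "trace (outer root\<pi> root\<pi>) = 1"
    by (simp add: trace_def outer_def root\<pi>_sq sum_\<pi>)
  then show ?thesis
    using bounded_linear.sums[OF bounded_linear_trace gram_scaled_deviation_sums]
    by (simp add: linear_diff[OF bounded_linear.linear[OF bounded_linear_trace]])
qed

lemma weighted_lq_summand_eq:
  "weighted_lq_summand P t = transpose (deviation t) ** diag_matrix \<pi> ** deviation t"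
proof -
  have "mat 1 - outer \<pi> 1 = transpose (mat 1 - outer 1 \<pi>)"
    by (simp add: transpose_diff) (simp add: vec_eq_iff transpose_def outer_def)
  moreover have "matrix_power P t ** (mat 1 - outer 1 \<pi>) = deviation t"
    by (simp add: matrix_diff_ldistrib power_outer deviation_def)
  ultimately show ?thesis
    unfolding weighted_lq_summand_def Let_def invariant_measure_eq matrix_power_transpose
    by (metis matrix_mul_assoc matrix_transpose_mul)
qed

lemma weighted_lq_summand_nth:
  "weighted_lq_summand P t $ i $ j = (\<Sum>k\<in>UNIV. \<pi> $ k * deviation t $ k $ i * deviation t $ k $ j)"
  unfolding weighted_lq_summand_eq matrix_mul_assoc[symmetric]
  by (simp add: matrix_matrix_mult_def[of "transpose (deviation t)"] diag_matrix_mult)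
     (simp add: transpose_def mult_ac)

lemma weighted_lq_summand_gram:
  "weighted_lq_summand P t = diag_matrix root\<pi> ** deviation_gram t ** diag_matrix root\<pi>"
proof -
  have "weighted_lq_summand P t $ i $ j = root\<pi> $ i * deviation_gram t $ i $ j * root\<pi> $ j" for i j
  proof -
    have s0: "root\<pi> $ i \<noteq> 0" "root\<pi> $ j \<noteq> 0"
      using root\<pi>_pos[of i] root\<pi>_pos[of j] by simp_all
    have "root\<pi> $ i * deviation_gram t $ i $ j * root\<pi> $ j
        = (\<Sum>k\<in>UNIV. root\<pi> $ i * ((root\<pi> $ k * deviation t $ k $ i / root\<pi> $ i) * (root\<pi> $ k *
            deviation t $ k $ j / root\<pi> $ j)) * root\<pi> $ j)"
      by (simp add: matrix_matrix_mult_def transpose_def scaled_deviation_def rescale_nth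
          sum_distrib_left sum_distrib_right)
    also have "\<dots> = (\<Sum>k\<in>UNIV. \<pi> $ k * deviation t $ k $ i * deviation t $ k $ j)"
      by (intro sum.cong refl) (simp add: s0 flip: root\<pi>_sq)
    finally show ?thesis
      by (simp add: weighted_lq_summand_nth)
  qed
  then show ?thesis
    by (simp add: vec_eq_iff matrix_mult_diag_matrix diag_matrix_mult)
qed

lemma summable_weighted_lq_summand: "summable (weighted_lq_summand P)"
proof -
  have "bounded_linear (\<lambda>Z. diag_matrix root\<pi> ** Z ** diag_matrix root\<pi>)"
    using bounded_linear_compose[OF
        bounded_bilinear.bounded_linear_left[OF bounded_bilinear_matrix_mult, of
            "diag_matrix root\<pi>"]
        bounded_bilinear.bounded_linear_right[OF bounded_bilinear_matrix_mult, of
            "diag_matrix root\<pi>"]]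
    by simp
  from bounded_linear.summable[OF this sums_summable[OF gram_scaled_deviation_sums]] show ?thesis
    unfolding weighted_lq_summand_gram[symmetric] .
qed

lemma trace_weighted_lq_sums: "(\<lambda>t. trace (weighted_lq_summand P t)) sums weighted_lq_cost P"
  unfolding weighted_lq_cost_def
  by (rule bounded_linear.sums[OF bounded_linear_trace summable_sums[OF
      summable_weighted_lq_summand]])

lemma trace_weighted_lq_scaled:
  "trace (weighted_lq_summand P t) = (\<Sum>i\<in>UNIV. \<pi> $ i * (\<Sum>k\<in>UNIV. (scaled_deviation t $ k $ i)\<^sup>2))"
  unfolding weighted_lq_summand_gram trace_def matrix_mult_diag_matrix diag_matrix_mult
      gram_scaled_deviation_diag
  by (intro sum.cong refl) (simp flip: root\<pi>_sq)

lemma trace_weighted_lq_deviation: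
  "trace (weighted_lq_summand P t) = (\<Sum>k\<in>UNIV. \<Sum>i\<in>UNIV. \<pi> $ k * (deviation t $ k $ i)\<^sup>2)"
  unfolding trace_def weighted_lq_summand_nth
  by (subst sum.swap) (simp add: power2_eq_square mult_ac)

lemma lq_summand_eq: "lq_summand P t = (\<Sum>k\<in>UNIV. \<Sum>i\<in>UNIV. (deviation t $ k $ i)\<^sup>2)"
  unfolding lq_summand_def invariant_measure_eq deviation_def[symmetric] power2_norm_eq_inner
      inner_matrix_eq
  by (simp add: power2_eq_square)

end

section \<open>Bounds on the costs\<close>

locale bounded_consensus_chain = consensus_chain +
  fixes m M :: real
  assumes m_pos: "0 < m" and m_le: "\<And>u. m \<le> \<pi> $ u" and le_M: "\<And>u. \<pi> $ u \<le> M"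
begin

lemma M_pos: "0 < M"
  using m_pos m_le[of undefined] le_M[of undefined] by linarith

lemma weighted_lq_cost_le: "weighted_lq_cost P \<le> M * (trace (gramian centred) - 1)"
proof (rule sums_le[OF _ trace_weighted_lq_sums sums_mult[OF trace_gram_scaled_deviation_sums]])
  show "trace (weighted_lq_summand P t) \<le> M * trace (deviation_gram t)" for t
    unfolding trace_weighted_lq_scaled trace_gram_scaled_deviation sum_distrib_left[of M
        "\<lambda>i. \<Sum>k\<in>UNIV. (scaled_deviation t $ k $ i)\<^sup>2"]
    by (intro sum_mono mult_right_mono le_M sum_nonneg) simp
qed

lemma weighted_lq_cost_ge: "m * (trace (gramian centred) - 1) \<le> weighted_lq_cost P"
proof (rule sums_le[OF _ sums_mult[OF trace_gram_scaled_deviation_sums] trace_weighted_lq_sums])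
  show "m * trace (deviation_gram t) \<le> trace (weighted_lq_summand P t)" for t
    unfolding trace_weighted_lq_scaled trace_gram_scaled_deviation sum_distrib_left[of m
        "\<lambda>i. \<Sum>k\<in>UNIV. (scaled_deviation t $ k $ i)\<^sup>2"]
    by (intro sum_mono mult_right_mono m_le sum_nonneg) simp
qed

lemma lq_summand_le: "m * lq_summand P t \<le> trace (weighted_lq_summand P t)"
  unfolding trace_weighted_lq_deviation lq_summand_eq sum_distrib_left
  by (intro sum_mono mult_right_mono m_le) simp

lemma lq_summand_ge: "trace (weighted_lq_summand P t) \<le> M * lq_summand P t"
  unfolding trace_weighted_lq_deviation lq_summand_eq sum_distrib_left
  by (intro sum_mono mult_right_mono le_M) simp

lemma summable_lq_summand: "summable (lq_summand P)"
proof (rule summable_comparison_test)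
  show "summable (\<lambda>t. trace (weighted_lq_summand P t) / m)"
    by (intro summable_divide sums_summable[OF trace_weighted_lq_sums])
  have "norm (lq_summand P t) \<le> trace (weighted_lq_summand P t) / m" for t
    using lq_summand_le[of t] m_pos by (simp add: lq_summand_def field_simps)
  then show "\<exists>N. \<forall>t\<ge>N. norm (lq_summand P t) \<le> trace (weighted_lq_summand P t) / m"
    by blast
qed

lemma lq_sums: "lq_summand P sums (n * lq_cost P)"
  using summable_sums[OF summable_lq_summand] by (simp add: lq_cost_def flip: n)

text \<open>
  The two costs differ only in the weights \<open>\<pi>\<^sub>k\<close> of the rows of the deviations, so bounds on
  \<open>\<pi>\<close> carry the estimates for the weighted cost over to the plain one.
\<close>

lemma lq_cost_le: "m * (n * lq_cost P) \<le> weighted_lq_cost P"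
  by (rule sums_le[OF lq_summand_le sums_mult[OF lq_sums] trace_weighted_lq_sums])

lemma lq_cost_ge: "weighted_lq_cost P \<le> M * (n * lq_cost P)"
  by (rule sums_le[OF lq_summand_ge trace_weighted_lq_sums sums_mult[OF lq_sums]])

lemma weighted_lq_cost_upper:
  "weighted_lq_cost P \<le> M ^ 3 * n ^ 3 * avg_effective_resistance conductance"
proof -
  note weighted_lq_cost_le
  also have "M * (trace (gramian centred) - 1) \<le> M * (trace green - 1)"
    using trace_gramian_le[OF strict_contraction_centred defect_inverse(1)] M_pos by simp
  also have "\<dots> \<le> M * (M\<^sup>2 * n ^ 3 * avg_effective_resistance conductance)"
    using trace_green_le[OF le_M] M_pos by simp
  also have "\<dots> = M ^ 3 * n ^ 3 * avg_effective_resistance conductance"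
    by (simp add: power2_eq_square power3_eq_cube)
  finally show ?thesis .
qed

lemma lq_cost_upper: "lq_cost P \<le> M ^ 3 * n ^ 2 / m * avg_effective_resistance conductance"
proof -
  have "m * (n * lq_cost P) \<le> M ^ 3 * n ^ 3 * avg_effective_resistance conductance"
    using lq_cost_le weighted_lq_cost_upper by (rule order_trans)
  also have "\<dots> = m * (n * (M ^ 3 * n ^ 2 / m * avg_effective_resistance conductance))"
    using m_pos by (simp add: power2_eq_square power3_eq_cube)
  finally show ?thesis
    using m_pos n_pos by (simp only: mult_le_cancel_left_pos)
qed

lemma weighted_lq_cost_lower:
  assumes "centred ** transpose centred = transpose centred ** centred"
  shows "m ^ 3 * n ^ 3 * avg_effective_resistance conductance \<le> weighted_lq_cost P"
proof -
  have "m ^ 3 * n ^ 3 * avg_effective_resistance conductance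
      = m * (m\<^sup>2 * n ^ 3 * avg_effective_resistance conductance)"
    by (simp add: power2_eq_square power3_eq_cube)
  also have "\<dots> \<le> m * (trace green - 1)"
    using trace_green_ge[OF m_le] m_pos by simp
  also have "\<dots> = m * (trace (gramian centred) - 1)"
    by (simp only: trace_gramian_normal[OF strict_contraction_centred defect_inverse(1) assms])
  also note weighted_lq_cost_ge
  finally show ?thesis .
qed

lemma lq_cost_lower:
  assumes "centred ** transpose centred = transpose centred ** centred"
  shows "m ^ 3 * n ^ 2 / M * avg_effective_resistance conductance \<le> lq_cost P"
proof -
  have "M * (n * (m ^ 3 * n ^ 2 / M * avg_effective_resistance conductance))
      = m ^ 3 * n ^ 3 * avg_effective_resistance conductance"
    using M_pos by (simp add: power2_eq_square power3_eq_cube)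
  also have "\<dots> \<le> M * (n * lq_cost P)"
    using weighted_lq_cost_lower[OF assms] lq_cost_ge by (rule order_trans)
  finally show ?thesis
    using M_pos n_pos by (simp only: mult_le_cancel_left_pos)
qed

end

section \<open>Time reversal\<close>

context consensus_chain
begin

lemma invertible_diag: "invertible (diag_matrix \<pi>)"
  and matrix_inv_diag: "matrix_inv (diag_matrix \<pi>) = diag_matrix (\<chi> u. 1 / \<pi> $ u)"
proof -
  have p0: "\<pi> $ u \<noteq> 0" for u
    using pos[of u] by simp
  have 1: "diag_matrix \<pi> ** diag_matrix (\<chi> u. 1 / \<pi> $ u) = mat 1"
      "diag_matrix (\<chi> u. 1 / \<pi> $ u) ** diag_matrix \<pi> = mat 1"
    by (simp_all add: vec_eq_iff diag_matrix_mult) (simp_all add: diag_matrix_def mat_def p0)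
  then show inv: "invertible (diag_matrix \<pi>)"
    unfolding invertible_def by blast
  have "matrix_inv (diag_matrix \<pi>) ** (diag_matrix \<pi> ** diag_matrix (\<chi> u. 1 / \<pi> $ u))
      = diag_matrix (\<chi> u. 1 / \<pi> $ u)"
    by (simp add: matrix_mul_assoc matrix_inv_mult(2)[OF inv])
  then show "matrix_inv (diag_matrix \<pi>) = diag_matrix (\<chi> u. 1 / \<pi> $ u)"
    by (simp add: 1)
qed

definition reversal :: "real ^ 'n ^ 'n" where
  "reversal = matrix_inv (diag_matrix \<pi>) ** transpose P ** diag_matrix \<pi>"

lemma conductance_reversal: "conductance = n *\<^sub>R (diag_matrix \<pi> ** reversal ** P)"
  by (simp add: conductance_def reversal_def matrix_mul_assoc matrix_inv_mult[OF invertible_diag])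

lemma rescale_reversal: "rescale \<pi> reversal = transpose (rescale \<pi> P)"
proof -
  have "root\<pi> $ u \<noteq> 0" for u
    using root\<pi>_pos[of u] by simp
  then show ?thesis
    by (simp add: vec_eq_iff reversal_def rescale_nth matrix_mult_diag_matrix matrix_inv_diag
        diag_matrix_mult)
       (simp add: transpose_def rescale_nth flip: root\<pi>_sq)
qed

text \<open>
  The hypothesis says that \<open>rescale \<pi> P\<close> is normal; subtracting the projection onto \<open>\<surd>\<pi>\<close>
  keeps it so, because \<open>\<surd>\<pi>\<close> is fixed by this matrix and by its transpose.
\<close>

lemma normal_centred:
  assumes "P ** reversal = reversal ** P"
  shows "centred ** transpose centred = transpose centred ** centred"
proof -
  define S where "S = rescale \<pi> P"
  have s0: "root\<pi> $ u \<noteq> 0" for u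
    using root\<pi>_pos[of u] by simp
  have SS: "S ** transpose S = transpose S ** S"
    unfolding S_def rescale_reversal[symmetric] rescale_mult[OF pos, symmetric] assms ..
  have centred: "centred = S - outer root\<pi> root\<pi>"
    by (simp add: vec_eq_iff centred_def S_def rescale_nth outer_def right_diff_distrib
        diff_divide_distrib s0 flip: root\<pi>_sq)
  have "outer root\<pi> root\<pi> = rescale \<pi> (outer 1 \<pi>)"
    by (simp add: vec_eq_iff rescale_nth outer_def s0 flip: root\<pi>_sq)
  then have fix1: "S ** outer root\<pi> root\<pi> = outer root\<pi> root\<pi>"
      "outer root\<pi> root\<pi> ** S = outer root\<pi> root\<pi>"
    by (simp_all add: S_def mult_outer outer_mult flip: rescale_mult[OF pos])
  have fix2: "transpose S ** outer root\<pi> root\<pi> = outer root\<pi> root\<pi>"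
      "outer root\<pi> root\<pi> ** transpose S = outer root\<pi> root\<pi>"
    using arg_cong[OF fix1(2), of transpose] arg_cong[OF fix1(1), of transpose]
    by (simp_all only: matrix_transpose_mul transpose_outer_root\<pi>)
  have "centred ** transpose centred = S ** transpose S - outer root\<pi> root\<pi>"
      "transpose centred ** centred = transpose S ** S - outer root\<pi> root\<pi>"
    unfolding centred transpose_diff transpose_outer_root\<pi>
    by (simp_all add: matrix_diff_ldistrib matrix_diff_rdistrib fix1 fix2 outer_root\<pi>_idem)
  then show ?thesis
    by (simp only: SS)
qed

end

section \<open>Comparison with the average effective resistance\<close>

theorem theorem3p3:
  fixes P Pstar C :: "real ^ 'n ^ 'n" and \<pi> :: "real ^ 'n" and n \<pi>min \<pi>max :: real
  assumes "consensus_matrix P"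
    and "n = real CARD('n)"
    and "\<pi> = invariant_measure P"
    and "Pstar = matrix_inv (diag_matrix \<pi>) ** transpose P ** diag_matrix \<pi>"
    and "C = n *\<^sub>R (diag_matrix \<pi> ** Pstar ** P)"
    and "\<pi>min = Min (range (\<lambda>u. \<pi> $ u))"
    and "\<pi>max = Max (range (\<lambda>u. \<pi> $ u))"
  shows "C = n *\<^sub>R (transpose P ** diag_matrix \<pi> ** P) \<and>
    conductance_matrix C \<and>
    summable (lq_summand P) \<and>
    summable (weighted_lq_summand P) \<and>
    lq_cost P \<le> \<pi>max ^ 3 * n ^ 2 / \<pi>min * avg_effective_resistance C \<and>
    weighted_lq_cost P \<le> \<pi>max ^ 3 * n ^ 3 * avg_effective_resistance C \<and>
    (P ** Pstar = Pstar ** P \<longrightarrow>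
       lq_cost P \<ge> \<pi>min ^ 3 * n ^ 2 / \<pi>max * avg_effective_resistance C \<and>
       weighted_lq_cost P \<ge> \<pi>min ^ 3 * n ^ 3 * avg_effective_resistance C)"
proof -
  interpret chain: consensus_chain P \<pi> n
    using assms(1-3) is_invariant_measure_invariant_measure by unfold_locales auto
  have "\<pi>min \<in> range (\<lambda>u. \<pi> $ u)"
    unfolding assms(6) by (rule Min_in) auto
  then have "0 < \<pi>min"
    using chain.pos by auto
  then interpret chain: bounded_consensus_chain P \<pi> n \<pi>min \<pi>max
    by unfold_locales (simp_all add: assms(6,7))
  have Pstar: "Pstar = chain.reversal"
    by (simp only: assms(4) chain.reversal_def)
  have C: "C = chain.conductance"
    by (simp only: assms(5) Pstar chain.conductance_reversal)
  show ?thesis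
    unfolding C Pstar
    using chain.conductance_def chain.conductance_matrix_conductance chain.summable_lq_summand
        chain.summable_weighted_lq_summand
      chain.lq_cost_upper chain.weighted_lq_cost_upper
      chain.lq_cost_lower[OF chain.normal_centred] chain.weighted_lq_cost_lower[OF
          chain.normal_centred]
    by blast
qed

end
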